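(* Let $G$ be a finite group and let $N < M$ be normal subgroups of $G$ (with $N$ properly contained in $M$), with $g \in M \setminus N$. Assume that $g^G = M \setminus N$ and $\mathrm{Irr}(G/N \mid M/N) = \{\chi\}$. Then there is a prime $p$ such that the following are true: (a) $$|C_G(g)| = \frac{|G:M|\,(|G:M| + \chi(1)^2)}{\chi(1)^2} = |C_{G/N}(gN)| = |G/N|_p.$$ In particular, $C_G(g)$ is a $p$-group. (b) Viewing $\chi$ as a character of $G$, $\chi(x) = |G:M|_{p'}\sqrt{|G:M|_p}$ if $x \in N$; $\chi(x) = -\dfrac{|G:M|}{\chi(1)} = -\sqrt{|G:M|_p}$ if $x \in g^G = M \setminus N$; and $\chi(x) = 0$ if $x \in G \setminus M$.
   Context: All groups are finite and characters are complex. $g^G$ is the conjugacy class of $g$ in $G$ and $C_G(g)$ its centralizer. $\mathrm{Irr}(G/N\mid M/N)$ is the set of irreducible complex characters of $G/N$ whose kernel does not contain $M/N$. Characters of $G/N$ are identified by inflation with characters of $G$ having $N$ in their kernel. For a positive integer $n$ and a prime $p$, $n_p$ is the largest power of $p$ dividing $n$, and $n_{p'} = n/n_p$; $|G:M|_p$, $|G/N|_p$, etc. are to be read accordingly. *)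

theory Defs
  imports
    "HOL-Algebra.Coset"
    "HOL-Computational_Algebra.Primes"
    "Jordan_Normal_Form.VS_Connect"
begin

definition conj_class :: "('a, 'b) monoid_scheme \<Rightarrow> 'a \<Rightarrow> 'a set" where
  "conj_class G x = {h \<otimes>\<^bsub>G\<^esub> x \<otimes>\<^bsub>G\<^esub> inv\<^bsub>G\<^esub> h | h. h \<in> carrier G}"

definition centralizer :: "('a, 'b) monoid_scheme \<Rightarrow> 'a \<Rightarrow> 'a set" where
  "centralizer G x = {h \<in> carrier G. h \<otimes>\<^bsub>G\<^esub> x = x \<otimes>\<^bsub>G\<^esub> h}"

definition group_index :: "('a, 'b) monoid_scheme \<Rightarrow> 'a set \<Rightarrow> nat" where
  "group_index G H = card (rcosets\<^bsub>G\<^esub> H)"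

definition p_part :: "nat \<Rightarrow> nat \<Rightarrow> nat" where
  "p_part p n = p ^ multiplicity p n"

definition p'_part :: "nat \<Rightarrow> nat \<Rightarrow> nat" where
  "p'_part p n = n div p_part p n"

definition GL :: "nat \<Rightarrow> complex mat monoid" where
  "GL n = units_of (ring_mat TYPE(complex) n ())"

definition mat_trace :: "complex mat \<Rightarrow> complex" where
  "mat_trace A = (\<Sum>i<dim_row A. A $$ (i, i))"

definition representation ::
    "('a, 'b) monoid_scheme \<Rightarrow> nat \<Rightarrow> ('a \<Rightarrow> complex mat) \<Rightarrow> bool" where
  "representation G n \<rho> \<longleftrightarrow> \<rho> \<in> hom G (GL n)"

definition irreducible_representation ::
    "('a, 'b) monoid_scheme \<Rightarrow> nat \<Rightarrow> ('a \<Rightarrow> complex mat) \<Rightarrow> bool" where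
  "irreducible_representation G n \<rho> \<longleftrightarrow>
     representation G n \<rho> \<and> n > 0 \<and>
     (\<forall>W. subspace class_ring W (module_vec TYPE(complex) n) \<and>
          (\<forall>x\<in>carrier G. \<forall>w\<in>W. \<rho> x *\<^sub>v w \<in> W)
          \<longrightarrow> W = {0\<^sub>v n} \<or> W = carrier_vec n)"

text \<open>
  Characters are restricted to the carrier (with value \<^const>\<open>undefined\<close> elsewhere),
  so that equality of characters is equality of HOL functions.
\<close>

definition rep_character ::
    "('a, 'b) monoid_scheme \<Rightarrow> ('a \<Rightarrow> complex mat) \<Rightarrow> 'a \<Rightarrow> complex" where
  "rep_character G \<rho> = (\<lambda>x\<in>carrier G. mat_trace (\<rho> x))"

definition Irr :: "('a, 'b) monoid_scheme \<Rightarrow> ('a \<Rightarrow> complex) set" where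
  "Irr G = {rep_character G \<rho> | n \<rho>. irreducible_representation G n \<rho>}"

definition char_kernel :: "('a, 'b) monoid_scheme \<Rightarrow> ('a \<Rightarrow> complex) \<Rightarrow> 'a set" where
  "char_kernel G \<chi> = {x \<in> carrier G. \<chi> x = \<chi> \<one>\<^bsub>G\<^esub>}"

definition Irr_over ::
    "('a, 'b) monoid_scheme \<Rightarrow> 'a set \<Rightarrow> ('a \<Rightarrow> complex) set" where
  "Irr_over G K = {\<chi> \<in> Irr G. \<not> K \<subseteq> char_kernel G \<chi>}"

definition inflation ::
    "('a, 'b) monoid_scheme \<Rightarrow> 'a set \<Rightarrow> ('a set \<Rightarrow> complex) \<Rightarrow> 'a \<Rightarrow> complex" where
  "inflation G N \<chi> = (\<lambda>x\<in>carrier G. \<chi> (N #>\<^bsub>G\<^esub> x))"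

end

theory Submission
  imports
    Defs
    "Jordan_Normal_Form.DL_Rank"
    "Jordan_Normal_Form.Schur_Decomposition"
    "HOL-Algebra.Group_Action"
    "HOL-Algebra.Sylow"
    "HOL-Algebra.Multiplicative_Group"
begin

text \<open>
  Write \<open>Q = G/N\<close>, \<open>A = M/N\<close>, \<open>a = |A|\<close>, \<open>m = |Q:A| = |G:M|\<close> and \<open>d = \<chi>(1)\<close>. The proof determines
  \<open>\<chi>\<close> completely from counting, and then finds the prime power structure from two divisibilities.

  \<^emph>\<open>Values.\<close> The irreducible characters of \<open>Q\<close> other than \<open>\<chi>\<close> are those of \<open>Q/A\<close>, so subtracting the
  regular character of \<open>Q/A\<close> from that of \<open>Q\<close> leaves a multiple \<open>k\<chi>\<close>. In the form used here: for each
  representation, the character minus its average over the cosets of \<open>A\<close> is a multiple of \<open>\<chi>\<close>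
  (\<open>character_multiplicity\<close>), because along a composition series every irreducible factor is
  either trivial on \<open>A\<close>, and contributes nothing, or has average zero and contributes \<open>\<chi>\<close>. For the
  regular representation, \<open>k\<chi>\<close> takes the value \<open>m(a - 1)\<close> at \<open>1\<close>, \<open>-m\<close> on the rest of \<open>A\<close>,
  and \<open>0\<close> off \<open>A\<close>. Since \<open>\<chi>\<close> has norm one (\<open>irreducible_character_norm\<close>), \<open>k\<^sup>2 = m(a - 1) = kd\<close>, so
  \<open>k = d\<close> and \<open>d\<^sup>2 = m(a - 1)\<close> (\<open>sole_character_values\<close>).

  \<^emph>\<open>Arithmetic.\<close> The nonidentity elements of \<open>A\<close> are conjugate, so by Cauchy's theorem only one
  prime \<open>p\<close> divides \<open>a\<close>. For a prime \<open>r \<noteq> p\<close>, a Sylow \<open>r\<close>-subgroup of \<open>Q\<close> meets \<open>A\<close> trivially, so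
  \<open>\<chi>\<close> vanishes on its nonidentity elements; thus \<open>\<chi>\<close> restricts to a multiple of its regular character and
  its order divides \<open>d\<close> (\<open>subgroup_order_dvd_degree\<close>). Comparing \<open>r\<close>-parts in \<open>d\<^sup>2 = m(a - 1)\<close> shows
  that the \<open>p'\<close>-part of \<open>m\<close> divides \<open>a - 1\<close>. Conversely \<open>a - 1\<close> is a class size of \<open>Q\<close>, so it divides
  \<open>|Q| = ma\<close> and, being prime to \<open>p\<close>, divides the \<open>p'\<close>-part of \<open>m\<close>. Hence \<open>m = m\<^sub>p(a - 1)\<close>
  (\<open>prime_power_shape\<close>) and \<open>d = (a - 1)\<surd>m\<^sub>p\<close>.

  \<^emph>\<open>Centralizers.\<close> The class of \<open>g\<close> in \<open>G\<close> has \<open>|M| - |N| = (a - 1)|N|\<close> elements and the class of \<open>gN\<close>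
  in \<open>Q\<close> has \<open>a - 1\<close>. Both centralizers therefore have order \<open>ma/(a - 1) = m\<^sub>pa\<close>, the \<open>p\<close>-part of
  \<open>ma = |G/N|\<close>.
\<close>

section \<open>Traces of complex matrices\<close>

lemma mat_trace_mult_comm:
  assumes "A \<in> carrier_mat n m" "B \<in> carrier_mat m n"
  shows "mat_trace (A * B) = mat_trace (B * A)"
proof -
  have "mat_trace (A * B) = (\<Sum>i<n. \<Sum>j<m. A $$ (i,j) * B $$ (j,i))"
    using assms by (auto simp: mat_trace_def scalar_prod_def lessThan_atLeast0 intro!: sum.cong)
  also have "\<dots> = (\<Sum>j<m. \<Sum>i<n. B $$ (j,i) * A $$ (i,j))"
    by (subst sum.swap) (simp add: mult.commute)
  also have "\<dots> = mat_trace (B * A)"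
    using assms by (auto simp: mat_trace_def scalar_prod_def lessThan_atLeast0 intro!: sum.cong)
  finally show ?thesis .
qed

lemma mat_trace_conjugate:
  assumes "X \<in> carrier_mat n n" "P \<in> carrier_mat n n" "Q \<in> carrier_mat n n" "P * Q = 1\<^sub>m n"
  shows "mat_trace (Q * X * P) = mat_trace X"
proof -
  have "mat_trace (Q * X * P) = mat_trace (P * (Q * X))"
    using assms by (intro mat_trace_mult_comm) auto
  also have "P * (Q * X) = P * Q * X"
    using assms by (intro assoc_mult_mat[symmetric]) auto
  finally show ?thesis using assms by simp
qed

text \<open>
  A triangular matrix similar to an idempotent is idempotent, so its diagonal entries are
  \<open>0\<close> or \<open>1\<close>, and the trace counts the ones. This is what makes dimensions of fixed spaces
  natural numbers below.
\<close>
lemma mat_trace_idempotent: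
  assumes A: "A \<in> carrier_mat n n" and idem: "A * A = A"
  shows "\<exists>k::nat. mat_trace A = of_nat k"
proof -
  obtain es where "char_poly A = (\<Prod>a\<leftarrow>es. [:- a, 1:])"
    using char_poly_factorized[OF A] by blast
  then obtain B where B: "B \<in> carrier_mat n n" "upper_triangular B" "similar_mat A B"
    using schur_decomposition_exists[OF A] by blast
  obtain P Q where wit: "similar_mat_wit A B P Q"
    using B(3) by (auto simp: similar_mat_def)
  note w = similar_mat_witD2[OF A wit]
  have BQAP: "B = Q * A * P"
    using similar_mat_witD2(3)[OF B(1) similar_mat_wit_sym[OF wit]] .
  have tr: "mat_trace B = mat_trace A"
    unfolding BQAP using w by (intro mat_trace_conjugate) auto
  note P = w(6) and Q = w(7)
  note assoc = assoc_mult_mat[of _ n n _ n _ n]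
  have "B * B = Q * A * (P * Q) * (A * P)"
    unfolding BQAP using P Q A by (simp add: assoc del: w(1))
  also have "\<dots> = Q * (A * A) * P" unfolding w(1) using P Q A by (simp add: assoc)
  finally have BB: "B * B = B" by (simp add: idem BQAP)
  have diag: "B $$ (i,i) \<in> {0, 1}" if i: "i < n" for i
  proof -
    have "B $$ (i,i) = (\<Sum>j<n. B $$ (i,j) * B $$ (j,i))"
      using i B(1) by (subst BB[symmetric]) (simp add: scalar_prod_def lessThan_atLeast0)
    also have "\<dots> = (\<Sum>j\<in>{i}. B $$ (i,j) * B $$ (j,i))"
    proof (rule sum.mono_neutral_right)
      show "\<forall>j\<in>{..<n} - {i}. B $$ (i,j) * B $$ (j,i) = 0"
      proof
        fix j assume "j \<in> {..<n} - {i}"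
        then have "j < i \<or> i < j" "j < n" by auto
        then show "B $$ (i,j) * B $$ (j,i) = 0"
          using upper_triangularD[OF B(2), of j i] upper_triangularD[OF B(2), of i j] B(1) i by auto
      qed
    qed (use i in auto)
    finally show ?thesis by (auto simp: algebra_simps)
  qed
  have "mat_trace B = (\<Sum>i<n. B $$ (i,i))" using B(1) by (simp add: mat_trace_def)
  also have "\<dots> = (\<Sum>i<n. of_nat (if B $$ (i,i) = 1 then 1 else 0))"
  proof (rule sum.cong)
    fix i assume "i \<in> {..<n}"
    with diag[of i] have "B $$ (i,i) = 0 \<or> B $$ (i,i) = 1" by simp
    then show "B $$ (i,i) = of_nat (if B $$ (i,i) = 1 then 1 else 0)" by (elim disjE) simp_all
  qed simp
  also have "\<dots> = of_nat (\<Sum>i<n. if B $$ (i,i) = 1 then 1 else 0)" by (rule of_nat_sum[symmetric])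
  finally show ?thesis unfolding tr by (rule exI)
qed

section \<open>Bases adapted to a subspace\<close>

lemma subspace_vec_iff:
  "VectorSpace.subspace class_ring W (module_vec TYPE(complex) n) \<longleftrightarrow>
     W \<subseteq> carrier_vec n \<and> 0\<^sub>v n \<in> W \<and> (\<forall>v\<in>W. \<forall>w\<in>W. v + w \<in> W) \<and> (\<forall>c. \<forall>v\<in>W. c \<cdot>\<^sub>v v \<in> W)"
proof -
  interpret vec_space "TYPE(complex)" n .
  show ?thesis
    unfolding VectorSpace.subspace_def submodule_def
    using vec_vs vec_module by (auto simp: module_vec_simps class_ring_simps)
qed

text \<open>
  The columns of \<open>P\<close> are a basis of the whole space whose first \<open>r\<close> members are a basis of \<open>W\<close>, and
  \<open>Q = P\<^sup>-\<^sup>1\<close> reads off coordinates. The last two clauses say that the first \<open>r\<close> columns lie in \<open>W\<close> and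
  that vectors of \<open>W\<close> have no further coordinates; together they make the matrix \<open>QXP\<close> of a map \<open>X\<close>
  preserving \<open>W\<close> block upper triangular.
\<close>
lemma subspace_adapted_basis:
  assumes W: "VectorSpace.subspace class_ring W (module_vec TYPE(complex) n)"
    and nz: "W \<noteq> {0\<^sub>v n}" and proper: "W \<noteq> carrier_vec n"
  obtains r P Q where "0 < r" "r < n" "P \<in> carrier_mat n n" "Q \<in> carrier_mat n n"
    "P * Q = 1\<^sub>m n" "Q * P = 1\<^sub>m n"
    "\<And>j. j < r \<Longrightarrow> col P j \<in> W" "\<And>w i. w \<in> W \<Longrightarrow> r \<le> i \<Longrightarrow> i < n \<Longrightarrow> (Q *\<^sub>v w) $ i = 0"
proof -
  interpret vec_space "TYPE(complex)" n .
  note WW = W[unfolded subspace_vec_iff]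
  have sub: "submodule class_ring W V" using W by simp
  have bound: "finite S \<and> card S \<le> n" if "S \<subseteq> carrier_vec n" "lin_indpt S" for S
    using that li_le_dim[of S] dim_is_n fin_dim by auto
  have empty: "lin_indpt {}" by (simp add: lin_dep_def)
  obtain B where B: "finite B" "maximal B (\<lambda>S. S \<subseteq> W \<and> lin_indpt S)"
  proof -
    have "finite A \<and> card A \<le> n" if "A \<subseteq> W \<and> lin_indpt A" for A
      using that WW by (intro bound) auto
    with maximal_exists[of "\<lambda>S. S \<subseteq> W \<and> lin_indpt S" n "{}"] show ?thesis
      using empty that by auto
  qed
  then have BW: "B \<subseteq> W" "lin_indpt B" by (auto simp: maximal_def)
  have Bc: "B \<subseteq> carrier_vec n" using BW WW by auto
  have spanB: "W \<subseteq> span B"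
  proof
    fix w assume w: "w \<in> W"
    show "w \<in> span B"
    proof (rule ccontr)
      assume nw: "w \<notin> span B"
      have "B \<subseteq> span B" using in_own_span[of B] Bc by simp
      then have "w \<notin> B" using nw by auto
      moreover have "lin_indpt (B \<union> {w})"
        using lin_dep_iff_in_span[of B w] nw BW w WW \<open>w \<notin> B\<close> by auto
      moreover have "B \<union> {w} \<subseteq> W" using BW w by auto
      ultimately show False using B(2) unfolding maximal_def by blast
    qed
  qed
  obtain D where D: "finite D" "maximal D (\<lambda>S. S \<subseteq> carrier_vec n \<and> lin_indpt S \<and> B \<subseteq> S)"
  proof -
    have "finite A \<and> card A \<le> n" if "A \<subseteq> carrier_vec n \<and> lin_indpt A \<and> B \<subseteq> A" for A
      using that by (intro bound) auto
    with maximal_exists[of "\<lambda>S. S \<subseteq> carrier_vec n \<and> lin_indpt S \<and> B \<subseteq> S" n B] show ?thesis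
      using Bc BW that by auto
  qed
  then have D': "D \<subseteq> carrier_vec n" "lin_indpt D" "B \<subseteq> D" by (auto simp: maximal_def)
  have "maximal D (\<lambda>S. S \<subseteq> carrier_vec n \<and> lin_indpt S)"
    using D(2) D' unfolding maximal_def by (metis order_trans)
  then have basD: "basis D" using max_li_is_basis by blast
  have cardD: "card D = n" using dim_basis[OF D(1) basD] dim_is_n by simp
  obtain ws where ws: "set ws = B" "distinct ws" using finite_distinct_list[OF B(1)] by blast
  obtain us where us: "set us = D - B" "distinct us" using finite_distinct_list[of "D - B"] D(1) by blast
  define vs where "vs = ws @ us"
  have vs: "set vs = D" "distinct vs"
    using ws us D'(3) by (auto simp: vs_def)
  note vs = vs distinct_card[OF vs(2), unfolded vs(1) cardD, symmetric]
  define P where "P = mat_of_cols n vs"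
  have P: "P \<in> carrier_mat n n" using vs by (auto simp: P_def)
  have cols: "cols P = vs" using vs D' by (auto simp: P_def)
  have "det P \<noteq> 0"
    using det_rank_iff[OF P] lin_indpt_full_rank[OF P] cols vs D' by auto
  from det_non_zero_imp_unit[OF P this, of "()"]
  obtain Q where Q: "Q \<in> carrier_mat n n" "Q * P = 1\<^sub>m n" "P * Q = 1\<^sub>m n"
    by (auto simp: Units_def ring_mat_def)
  define r where "r = length ws"
  have colP: "col P j = vs ! j" if "j < n" for j
    using that vs D' unfolding P_def by (intro col_mat_of_cols) (auto dest: nth_mem)
  have rn: "r \<le> n" using vs(3) by (auto simp: r_def vs_def)
  have colW: "col P j \<in> W" if "j < r" for j
  proof -
    have "vs ! j = ws ! j" using that by (simp add: vs_def r_def nth_append)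
    then show ?thesis using colP[of j] that rn ws BW nth_mem[of j ws] by (auto simp: r_def)
  qed
  \<comment> \<open>The vectors without coordinates beyond the first \<open>r\<close> form a subspace containing \<open>B\<close>,
      hence containing \<open>W\<close>.\<close>
  let ?Z = "{w \<in> carrier_vec n. \<forall>i. r \<le> i \<longrightarrow> i < n \<longrightarrow> (Q *\<^sub>v w) $ i = 0}"
  have Z: "VectorSpace.subspace class_ring ?Z V"
    unfolding subspace_vec_iff using Q(1)
    by (auto simp: scalar_prod_add_distrib[of _ n] mult_mat_vec[of Q n n])
  have "B \<subseteq> ?Z"
  proof
    fix b assume "b \<in> B"
    then obtain j where j: "j < r" "b = ws ! j" using ws by (auto simp: r_def in_set_conv_nth)
    then have b: "b = col P j" using colP[of j] rn by (simp add: vs_def r_def nth_append)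
    have "Q *\<^sub>v b = col (Q * P) j" unfolding b using j rn Q(1) P by (intro eq_vecI) auto
    then have "Q *\<^sub>v b = unit_vec n j" using Q j rn by simp
    then show "b \<in> ?Z" using j \<open>b \<in> B\<close> Bc rn by auto
  qed
  then have "span B \<subseteq> ?Z" using Z by (intro span_is_subset) auto
  then have coords: "(Q *\<^sub>v w) $ i = 0" if "w \<in> W" "r \<le> i" "i < n" for w i
    using that spanB by auto
  have "r \<noteq> 0"
  proof
    assume "r = 0"
    then have "B = {}" using ws by (auto simp: r_def)
    then have "W \<subseteq> {0\<^sub>v n}" using spanB span_empty by auto
    then show False using nz WW by auto
  qed
  moreover have "r \<noteq> n"
  proof
    assume "r = n"
    then have "us = []" using vs(3) by (auto simp: r_def vs_def)
    then have "B = D" using us D' by auto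
    then have "span B = carrier_vec n" using basD by (auto simp: basis_def)
    moreover have "span B \<subseteq> W" using span_is_subset[OF BW(1) sub] .
    ultimately show False using proper WW by auto
  qed
  ultimately show ?thesis
    using that[of r P Q] rn P Q colW coords by auto
qed

section \<open>Sums of families of matrices\<close>

text \<open>
  Matrices of different sizes share one type and have no common zero, so the dimension \<open>n\<close> is given and
  the sum is formed entrywise.
\<close>
definition sum_mat :: "nat \<Rightarrow> ('b \<Rightarrow> complex mat) \<Rightarrow> 'b set \<Rightarrow> complex mat" where
  "sum_mat n f S = mat n n (\<lambda>ij. \<Sum>x\<in>S. f x $$ ij)"

lemma sum_mat_carrier [simp]: "sum_mat n f S \<in> carrier_mat n n"
  by (simp add: sum_mat_def)

lemma sum_mat_cong:
  "(\<And>x. x \<in> S \<Longrightarrow> f x = h x) \<Longrightarrow> sum_mat n f S = sum_mat n h S"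
  by (simp add: sum_mat_def)

lemma sum_mat_reindex:
  assumes "bij_betw h S T"
  shows "sum_mat n (\<lambda>x. f (h x)) S = sum_mat n f T"
  unfolding sum_mat_def using sum.reindex_bij_betw[OF assms, of "\<lambda>x. f x $$ _"] by simp

lemma mult_sum_mat:
  assumes "X \<in> carrier_mat n n" "\<And>x. x \<in> S \<Longrightarrow> f x \<in> carrier_mat n n"
  shows "X * sum_mat n f S = sum_mat n (\<lambda>x. X * f x) S"
proof (rule eq_matI)
  fix i j assume "i < dim_row (sum_mat n (\<lambda>x. X * f x) S)" "j < dim_col (sum_mat n (\<lambda>x. X * f x) S)"
  then have ij: "i < n" "j < n" by (auto simp: sum_mat_def)
  have "(X * sum_mat n f S) $$ (i,j) = (\<Sum>k<n. \<Sum>x\<in>S. X $$ (i,k) * f x $$ (k,j))"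
    using ij assms(1) by (simp add: sum_mat_def scalar_prod_def lessThan_atLeast0 sum_distrib_left)
  also have "\<dots> = (\<Sum>x\<in>S. \<Sum>k<n. X $$ (i,k) * f x $$ (k,j))" by (rule sum.swap)
  also have "\<dots> = (\<Sum>x\<in>S. (X * f x) $$ (i,j))"
  proof (rule sum.cong)
    fix x assume "x \<in> S"
    with assms(2)[OF this] ij assms(1) show "(\<Sum>k<n. X $$ (i,k) * f x $$ (k,j)) = (X * f x) $$ (i,j)"
      by (simp add: scalar_prod_def lessThan_atLeast0)
  qed simp
  finally show "(X * sum_mat n f S) $$ (i,j) = sum_mat n (\<lambda>x. X * f x) S $$ (i,j)"
    using ij by (simp add: sum_mat_def)
qed (use assms in \<open>auto simp: sum_mat_def\<close>)

lemma sum_mat_mult: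
  assumes "X \<in> carrier_mat n n" "\<And>x. x \<in> S \<Longrightarrow> f x \<in> carrier_mat n n"
  shows "sum_mat n f S * X = sum_mat n (\<lambda>x. f x * X) S"
proof (rule eq_matI)
  fix i j assume "i < dim_row (sum_mat n (\<lambda>x. f x * X) S)" "j < dim_col (sum_mat n (\<lambda>x. f x * X) S)"
  then have ij: "i < n" "j < n" by (auto simp: sum_mat_def)
  have "(sum_mat n f S * X) $$ (i,j) = (\<Sum>k<n. \<Sum>x\<in>S. f x $$ (i,k) * X $$ (k,j))"
    using ij assms(1) by (simp add: sum_mat_def scalar_prod_def lessThan_atLeast0 sum_distrib_right)
  also have "\<dots> = (\<Sum>x\<in>S. \<Sum>k<n. f x $$ (i,k) * X $$ (k,j))" by (rule sum.swap)
  also have "\<dots> = (\<Sum>x\<in>S. (f x * X) $$ (i,j))"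
  proof (rule sum.cong)
    fix x assume "x \<in> S"
    with assms(2)[OF this] ij assms(1) show "(\<Sum>k<n. f x $$ (i,k) * X $$ (k,j)) = (f x * X) $$ (i,j)"
      by (simp add: scalar_prod_def lessThan_atLeast0)
  qed simp
  finally show "(sum_mat n f S * X) $$ (i,j) = sum_mat n (\<lambda>x. f x * X) S $$ (i,j)"
    using ij by (simp add: sum_mat_def)
qed (use assms in \<open>auto simp: sum_mat_def\<close>)

lemma mat_trace_sum_mat:
  assumes "\<And>x. x \<in> S \<Longrightarrow> f x \<in> carrier_mat n n"
  shows "mat_trace (sum_mat n f S) = (\<Sum>x\<in>S. mat_trace (f x))"
proof -
  have "mat_trace (sum_mat n f S) = (\<Sum>x\<in>S. \<Sum>i<n. f x $$ (i,i))"
    by (simp add: mat_trace_def sum_mat_def sum.swap[of _ "{..<n}"])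
  also have "\<dots> = (\<Sum>x\<in>S. mat_trace (f x))"
    using assms by (intro sum.cong) (auto simp: mat_trace_def)
  finally show ?thesis .
qed

lemma sum_mat_const:
  assumes "X \<in> carrier_mat n n"
  shows "sum_mat n (\<lambda>x. X) S = of_nat (card S) \<cdot>\<^sub>m X"
  using assms by (auto simp: sum_mat_def intro!: eq_matI)

lemma index_mult_mat_sum:
  assumes "X \<in> carrier_mat n m" "Y \<in> carrier_mat m l" "i < n" "j < l"
  shows "(X * Y) $$ (i,j) = (\<Sum>k<m. X $$ (i,k) * Y $$ (k,j))"
  using assms by (simp add: scalar_prod_def atLeast0LessThan)

lemma mat_eq_by_action:
  fixes X Y :: "complex mat"
  assumes X: "X \<in> carrier_mat n n" and Y: "Y \<in> carrier_mat n n"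
    and eq: "\<And>v. v \<in> carrier_vec n \<Longrightarrow> X *\<^sub>v v = Y *\<^sub>v v"
  shows "X = Y"
proof (rule eq_matI)
  fix i j assume "i < dim_row Y" "j < dim_col Y"
  then have ij: "i < n" "j < n" using Y by auto
  have "X $$ (i,j) = (X *\<^sub>v unit_vec n j) $ i" "Y $$ (i,j) = (Y *\<^sub>v unit_vec n j) $ i"
    using ij X Y by simp_all
  then show "X $$ (i,j) = Y $$ (i,j)" using eq[of "unit_vec n j"] by simp
qed (use X Y in auto)

section \<open>Schur's lemma and the norm of an irreducible character\<close>

context group
begin

text \<open>
  Values in \<^const>\<open>GL\<close> amount to square matrices with \<open>\<one>\<close> sent to the identity, because
  \<open>\<rho> (inv x)\<close> is then an inverse of \<open>\<rho> x\<close>.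
\<close>
lemma representation_iff:
  "representation G n \<rho> \<longleftrightarrow>
     (\<forall>x\<in>carrier G. \<rho> x \<in> carrier_mat n n) \<and> \<rho> \<one> = 1\<^sub>m n \<and>
     (\<forall>x\<in>carrier G. \<forall>y\<in>carrier G. \<rho> (x \<otimes> y) = \<rho> x * \<rho> y)" (is "?l \<longleftrightarrow> ?r")
proof
  interpret R: ring "ring_mat TYPE(complex) n ()" by (rule ring_mat)
  have GL: "Group.group (GL n)" unfolding GL_def by (rule R.units_group)
  {
    assume ?l
    then have h: "\<rho> \<in> hom G (GL n)" by (simp add: representation_def)
    interpret gh: group_hom G "GL n" \<rho>
      using h GL by (simp add: group_hom_def group_hom_axioms_def is_group)
    have "\<rho> \<one> = 1\<^sub>m n" using gh.hom_one by (simp add: GL_def units_of_def ring_mat_simps)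
    moreover have "\<rho> x \<in> carrier_mat n n" if "x \<in> carrier G" for x
      using gh.hom_closed[OF that] by (simp add: GL_def units_of_def Units_def ring_mat_simps)
    moreover have "\<rho> (x \<otimes> y) = \<rho> x * \<rho> y" if "x \<in> carrier G" "y \<in> carrier G" for x y
      using gh.hom_mult[OF that] by (simp add: GL_def units_of_def ring_mat_simps)
    ultimately show ?r by blast
  }
  {
    assume r: ?r
    have "\<rho> x \<in> Units (ring_mat TYPE(complex) n ())" if x: "x \<in> carrier G" for x
    proof -
      have "\<rho> x * \<rho> (inv x) = 1\<^sub>m n" "\<rho> (inv x) * \<rho> x = 1\<^sub>m n"
        using r x by (metis inv_closed r_inv, metis inv_closed l_inv x)
      moreover have "\<rho> x \<in> carrier_mat n n" "\<rho> (inv x) \<in> carrier_mat n n" using r x by auto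
      ultimately show ?thesis by (auto simp: Units_def ring_mat_simps)
    qed
    then show ?l using r
      by (auto simp: representation_def hom_def GL_def units_of_def ring_mat_simps)
  }
qed

lemma representationD:
  assumes "representation G n \<rho>"
  shows "x \<in> carrier G \<Longrightarrow> \<rho> x \<in> carrier_mat n n" "\<rho> \<one> = 1\<^sub>m n"
    "x \<in> carrier G \<Longrightarrow> y \<in> carrier G \<Longrightarrow> \<rho> (x \<otimes> y) = \<rho> x * \<rho> y"
  using assms unfolding representation_iff by auto

text \<open>
  The kernel of a matrix commuting with the representation is an invariant subspace.
\<close>
lemma intertwiner_zero_or_injective:
  assumes irr: "irreducible_representation G n \<rho>"
    and X: "X \<in> carrier_mat n n"
    and comm: "\<And>x. x \<in> carrier G \<Longrightarrow> X * \<rho> x = \<rho> x * X"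
  shows "X = 0\<^sub>m n n \<or> (\<forall>v\<in>carrier_vec n. X *\<^sub>v v = 0\<^sub>v n \<longrightarrow> v = 0\<^sub>v n)"
proof -
  have rep: "representation G n \<rho>" using irr by (simp add: irreducible_representation_def)
  note R = representationD[OF rep]
  let ?W = "{v \<in> carrier_vec n. X *\<^sub>v v = 0\<^sub>v n}"
  have "VectorSpace.subspace class_ring ?W (module_vec TYPE(complex) n)"
    unfolding subspace_vec_iff using X
    by (auto simp: mult_add_distrib_mat_vec[of X n n] mult_mat_vec[of X n n])
  moreover have "\<rho> x *\<^sub>v w \<in> ?W" if "x \<in> carrier G" "w \<in> ?W" for x w
  proof -
    have "X *\<^sub>v (\<rho> x *\<^sub>v w) = (X * \<rho> x) *\<^sub>v w"
      using X R(1) that by (intro assoc_mult_mat_vec[symmetric]) auto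
    also have "\<dots> = \<rho> x *\<^sub>v (X *\<^sub>v w)"
      unfolding comm[OF that(1)] using X R(1) that by (intro assoc_mult_mat_vec) auto
    also have "\<dots> = 0\<^sub>v n" using R(1)[OF that(1)] that(2) by (auto intro!: eq_vecI)
    finally show ?thesis using R(1)[OF that(1)] that(2) by auto
  qed
  ultimately have "?W = {0\<^sub>v n} \<or> ?W = carrier_vec n"
    using irr unfolding irreducible_representation_def by blast
  then show ?thesis
  proof
    assume "?W = carrier_vec n"
    then have z: "X *\<^sub>v v = 0\<^sub>v n" if "v \<in> carrier_vec n" for v using that by blast
    have "X = 0\<^sub>m n n"
      using X z by (intro mat_eq_by_action) auto
    then show ?thesis ..
  qed blast
qed

text \<open>
  Over the complex numbers \<open>X\<close> has an eigenvalue \<open>c\<close>, and then \<open>X - c\<close> is an intertwiner that is not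
  injective.
\<close>
lemma schur_scalar:
  assumes irr: "irreducible_representation G n \<rho>"
    and X: "X \<in> carrier_mat n n"
    and comm: "\<And>x. x \<in> carrier G \<Longrightarrow> X * \<rho> x = \<rho> x * X"
  obtains c where "X = c \<cdot>\<^sub>m 1\<^sub>m n"
proof -
  have n: "n > 0" and rep: "representation G n \<rho>"
    using irr by (auto simp: irreducible_representation_def)
  note R = representationD[OF rep]
  obtain as where as: "char_poly X = (\<Prod>a\<leftarrow>as. [:- a, 1:])" "length as = n"
    using char_poly_factorized[OF X] by blast
  then obtain c as' where "as = c # as'" using n by (cases as) auto
  then have "poly (char_poly X) c = 0" using as by simp
  then have "eigenvalue X c" using eigenvalue_root_char_poly[OF X] by simp
  then obtain v where v: "v \<in> carrier_vec n" "v \<noteq> 0\<^sub>v n" "X *\<^sub>v v = c \<cdot>\<^sub>v v"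
    using X by (auto simp: eigenvalue_def eigenvector_def)
  let ?Y = "X - c \<cdot>\<^sub>m 1\<^sub>m n"
  have Y: "?Y \<in> carrier_mat n n" by (auto intro!: minus_carrier_mat)
  have "?Y *\<^sub>v v = 0\<^sub>v n"
    using X v by (simp add: minus_mult_distrib_mat_vec[of X n n])
      (auto intro!: eq_vecI)
  moreover have "?Y * \<rho> x = \<rho> x * ?Y" if "x \<in> carrier G" for x
    using R(1)[OF that] X comm[OF that]
    by (simp add: minus_mult_distrib_mat[of X n n] mult_minus_distrib_mat[of _ n n]
        mult_smult_assoc_mat[of _ n n] mult_smult_distrib[of _ n n _ n])
  ultimately have "?Y = 0\<^sub>m n n"
    using intertwiner_zero_or_injective[OF irr Y] v by blast
  have "X = c \<cdot>\<^sub>m 1\<^sub>m n"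
  proof (rule eq_matI)
    fix i j assume "i < dim_row (c \<cdot>\<^sub>m 1\<^sub>m n)" "j < dim_col (c \<cdot>\<^sub>m 1\<^sub>m n)"
    then have ij: "i < n" "j < n" by auto
    have "?Y $$ (i,j) = 0" using \<open>?Y = 0\<^sub>m n n\<close> ij by simp
    then show "X $$ (i,j) = (c \<cdot>\<^sub>m 1\<^sub>m n) $$ (i,j)" using X ij by simp
  qed (use X in auto)
  then show ?thesis by (rule that)
qed

lemma bij_betw_left_mult:
  assumes "y \<in> carrier G" shows "bij_betw (\<lambda>x. y \<otimes> x) (carrier G) (carrier G)"
  by (rule bij_betw_byWitness[where f' = "\<lambda>x. inv y \<otimes> x"])
    (use assms in \<open>auto simp: m_assoc[symmetric]\<close>)

text \<open>
  Averaging the conjugates \<open>\<rho>(x) E \<rho>(x\<^sup>-\<^sup>1)\<close> of the matrix unit \<open>E = E\<^sub>j\<^sub>k\<close> gives an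
  intertwiner, hence a scalar by Schur's lemma. The trace determines the scalar, and the
  \<open>(j,k)\<close> entry of the average is the sum in question.
\<close>
lemma matrix_coefficient_orthogonality:
  assumes irr: "irreducible_representation G n \<rho>" and jk: "j < n" "k < n"
  shows "of_nat n * (\<Sum>x\<in>carrier G. \<rho> x $$ (j,j) * \<rho> (inv x) $$ (k,k))
         = (if j = k then of_nat (Coset.order G) else 0)"
proof -
  have rep: "representation G n \<rho>" and n: "n > 0"
    using irr by (auto simp: irreducible_representation_def)
  note R = representationD[OF rep]
  define E :: "complex mat" where "E = mat n n (\<lambda>ij. if ij = (j,k) then 1 else 0)"
  have E: "E \<in> carrier_mat n n" by (simp add: E_def)
  define T where "T = sum_mat n (\<lambda>x. \<rho> x * E * \<rho> (inv x)) (carrier G)"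
  have cl: "\<rho> x * E * \<rho> (inv x) \<in> carrier_mat n n" if "x \<in> carrier G" for x
    using that R(1) E by (intro mult_carrier_mat) auto
  note assoc = assoc_mult_mat[of _ n n _ n _ n] mult_carrier_mat[of _ n n _ n]
  have comm: "T * \<rho> y = \<rho> y * T" if y: "y \<in> carrier G" for y
  proof -
    have "\<rho> y * T = sum_mat n (\<lambda>x. \<rho> y * (\<rho> x * E * \<rho> (inv x))) (carrier G)"
      unfolding T_def using y R(1) cl by (intro mult_sum_mat)
    also have "\<dots> = sum_mat n (\<lambda>x. \<rho> (y \<otimes> x) * E * (\<rho> (inv (y \<otimes> x)) * \<rho> y)) (carrier G)"
    proof (rule sum_mat_cong)
      fix x assume x: "x \<in> carrier G"
      have "\<rho> (inv (y \<otimes> x)) * \<rho> y = \<rho> (inv (y \<otimes> x) \<otimes> y)" using x y R(3) by simp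
      also have "inv (y \<otimes> x) \<otimes> y = inv x" using x y by (simp add: inv_mult_group m_assoc)
      finally show "\<rho> y * (\<rho> x * E * \<rho> (inv x)) = \<rho> (y \<otimes> x) * E * (\<rho> (inv (y \<otimes> x)) * \<rho> y)"
        using x y R(1) E by (simp add: R(3) assoc)
    qed
    also have "\<dots> = sum_mat n (\<lambda>x. \<rho> x * E * (\<rho> (inv x) * \<rho> y)) (carrier G)"
      using sum_mat_reindex[OF bij_betw_left_mult[OF y],
          of n "\<lambda>z. \<rho> z * E * (\<rho> (inv z) * \<rho> y)"] .
    also have "\<dots> = sum_mat n (\<lambda>x. \<rho> x * E * \<rho> (inv x) * \<rho> y) (carrier G)"
      using R(1) E y by (intro sum_mat_cong) (simp add: assoc)
    also have "\<dots> = T * \<rho> y"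
      unfolding T_def using y R(1) cl by (intro sum_mat_mult[symmetric])
    finally show ?thesis by simp
  qed
  obtain c where c: "T = c \<cdot>\<^sub>m 1\<^sub>m n"
    using schur_scalar[OF irr, of T] comm by (auto simp: T_def)
  have "mat_trace T = (\<Sum>x\<in>carrier G. mat_trace E)"
  proof -
    have "mat_trace (\<rho> x * E * \<rho> (inv x)) = mat_trace E" if x: "x \<in> carrier G" for x
      using x R(1) E R(3)[of "inv x" x] R(2) by (intro mat_trace_conjugate) auto
    then show ?thesis unfolding T_def using cl by (simp add: mat_trace_sum_mat)
  qed
  also have "mat_trace E = (if j = k then 1 else 0)"
  proof -
    have "mat_trace E = (\<Sum>i<n. if i = j then (if j = k then 1 else 0) else 0)"
      unfolding mat_trace_def E_def by (auto intro!: sum.cong)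
    then show ?thesis using jk by simp
  qed
  also have "mat_trace T = of_nat n * c" by (simp add: c mat_trace_def)
  finally have nc: "of_nat n * c = (if j = k then of_nat (Coset.order G) else 0)"
    by (simp add: Coset.order_def)
  have "(\<rho> x * E * \<rho> (inv x)) $$ (j,k) = \<rho> x $$ (j,j) * \<rho> (inv x) $$ (k,k)"
    if x: "x \<in> carrier G" for x
  proof -
    have r: "\<rho> x \<in> carrier_mat n n" "\<rho> (inv x) \<in> carrier_mat n n" using x R(1) by auto
    have "(\<rho> x * E) $$ (j,l) = (if l = k then \<rho> x $$ (j,j) else 0)" if "l < n" for l
    proof -
      have "(\<rho> x * E) $$ (j,l) = (\<Sum>i<n. \<rho> x $$ (j,i) * (if i = j \<and> l = k then 1 else 0))"
        using that jk r by (simp add: scalar_prod_def lessThan_atLeast0 E_def)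
      also have "\<dots> = (\<Sum>i<n. if i = j then (if l = k then \<rho> x $$ (j,j) else 0) else 0)"
        by (intro sum.cong) auto
      finally show ?thesis using jk by simp
    qed
    note entry = this
    have "(\<rho> x * E * \<rho> (inv x)) $$ (j,k) = (\<Sum>l<n. (\<rho> x * E) $$ (j,l) * \<rho> (inv x) $$ (l,k))"
      using jk r E by (intro index_mult_mat_sum[of _ n n _ n]) auto
    also have "\<dots> = (\<Sum>l<n. if l = k then \<rho> x $$ (j,j) * \<rho> (inv x) $$ (k,k) else 0)"
      by (intro sum.cong) (auto simp: entry simp del: index_mult_mat)
    finally show ?thesis using jk by simp
  qed
  then have "T $$ (j,k) = (\<Sum>x\<in>carrier G. \<rho> x $$ (j,j) * \<rho> (inv x) $$ (k,k))"
    using jk by (simp add: T_def sum_mat_def)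
  moreover have "T $$ (j,k) = (if j = k then c else 0)" using jk by (simp add: c)
  ultimately show ?thesis using nc by auto
qed

lemma irreducible_character_norm:
  assumes irr: "irreducible_representation G n \<rho>"
  shows "(\<Sum>x\<in>carrier G. mat_trace (\<rho> x) * mat_trace (\<rho> (inv x))) = of_nat (Coset.order G)"
proof -
  have rep: "representation G n \<rho>" and n: "n > 0"
    using irr by (auto simp: irreducible_representation_def)
  note R = representationD[OF rep]
  have "(\<Sum>x\<in>carrier G. mat_trace (\<rho> x) * mat_trace (\<rho> (inv x)))
      = (\<Sum>x\<in>carrier G. \<Sum>j<n. \<Sum>k<n. \<rho> x $$ (j,j) * \<rho> (inv x) $$ (k,k))"
  proof (rule sum.cong)
    fix x assume "x \<in> carrier G"
    then have "dim_row (\<rho> x) = n" "dim_row (\<rho> (inv x)) = n" using R(1) by auto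
    then show "mat_trace (\<rho> x) * mat_trace (\<rho> (inv x))
        = (\<Sum>j<n. \<Sum>k<n. \<rho> x $$ (j,j) * \<rho> (inv x) $$ (k,k))"
      by (simp add: mat_trace_def sum_product)
  qed simp
  also have "\<dots> = (\<Sum>j<n. \<Sum>k<n. \<Sum>x\<in>carrier G. \<rho> x $$ (j,j) * \<rho> (inv x) $$ (k,k))"
    by (subst sum.swap, intro sum.cong refl, rule sum.swap)
  finally have "of_nat n * (\<Sum>x\<in>carrier G. mat_trace (\<rho> x) * mat_trace (\<rho> (inv x)))
      = (\<Sum>j<n. \<Sum>k<n. of_nat n * (\<Sum>x\<in>carrier G. \<rho> x $$ (j,j) * \<rho> (inv x) $$ (k,k)))"
    by (simp only: sum_distrib_left)
  also have "\<dots> = (\<Sum>j<n. \<Sum>k<n. if j = k then of_nat (Coset.order G) else 0)"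
    by (intro sum.cong refl matrix_coefficient_orthogonality[OF irr]) auto
  also have "\<dots> = of_nat n * of_nat (Coset.order G)" by simp
  finally show ?thesis using n by simp
qed

end

section \<open>Characters modulo the average over a normal subgroup\<close>

lemma sum_lessThan_split:
  fixes f :: "nat \<Rightarrow> complex"
  assumes "r \<le> n"
  shows "(\<Sum>k<n. f k) = (\<Sum>k<r. f k) + (\<Sum>k<n-r. f (k + r))"
proof -
  have "(\<Sum>k<r+m. f k) = (\<Sum>k<r. f k) + (\<Sum>k<m. f (k + r))" for m
    by (induction m) (simp_all add: add.assoc add.commute[of r])
  from this[of "n - r"] show ?thesis using assms by simp
qed

context group
begin

text \<open>
  In a basis adapted to \<open>W\<close> all matrices are block upper triangular; the diagonal blocks are the
  representations on \<open>W\<close> and on the quotient by \<open>W\<close>. Only the traces matter later, so no invariant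
  complement is constructed.
\<close>
lemma invariant_subspace_splits_trace:
  assumes rep: "representation G n \<rho>"
    and W: "VectorSpace.subspace class_ring W (module_vec TYPE(complex) n)"
    and inv: "\<And>x w. x \<in> carrier G \<Longrightarrow> w \<in> W \<Longrightarrow> \<rho> x *\<^sub>v w \<in> W"
    and nz: "W \<noteq> {0\<^sub>v n}" and proper: "W \<noteq> carrier_vec n"
  obtains r \<rho>1 \<rho>2 where "0 < r" "r < n" "representation G r \<rho>1" "representation G (n - r) \<rho>2"
    "\<And>x. x \<in> carrier G \<Longrightarrow> mat_trace (\<rho> x) = mat_trace (\<rho>1 x) + mat_trace (\<rho>2 x)"
proof -
  note R = representationD[OF rep]
  obtain r P Q where r: "0 < r" "r < n" and P: "P \<in> carrier_mat n n" and Q: "Q \<in> carrier_mat n n"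
    and PQ: "P * Q = 1\<^sub>m n" "Q * P = 1\<^sub>m n"
    and colP: "\<And>j. j < r \<Longrightarrow> col P j \<in> W"
    and QW: "\<And>w i. w \<in> W \<Longrightarrow> r \<le> i \<Longrightarrow> i < n \<Longrightarrow> (Q *\<^sub>v w) $ i = 0"
    using subspace_adapted_basis[OF W nz proper] by metis
  note assoc = assoc_mult_mat[of _ n n _ n _ n] mult_carrier_mat[of _ n n _ n]
  define X where "X x = Q * \<rho> x * P" for x
  have X: "X x \<in> carrier_mat n n" if "x \<in> carrier G" for x
    using R(1)[OF that] P Q by (simp add: X_def assoc)
  have Xm: "X (x \<otimes> y) = X x * X y" if x: "x \<in> carrier G" and y: "y \<in> carrier G" for x y
  proof -
    have "X x * X y = Q * \<rho> x * (P * Q) * (\<rho> y * P)"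
      using R(1)[OF x] R(1)[OF y] P Q unfolding X_def by (simp add: assoc)
    also have "\<dots> = X (x \<otimes> y)"
      unfolding PQ using R(1)[OF x] R(1)[OF y] P Q R(3)[OF x y] by (simp add: X_def assoc)
    finally show ?thesis by simp
  qed
  have X1: "X \<one> = 1\<^sub>m n" using P Q PQ R(2) by (simp add: X_def)
  have block: "X x $$ (i,j) = 0" if x: "x \<in> carrier G" and i: "r \<le> i" "i < n" and j: "j < r" for x i j
  proof -
    have "X x = Q * (\<rho> x * P)" using R(1)[OF x] P Q by (simp add: X_def assoc)
    moreover have "col (\<rho> x * P) j = \<rho> x *\<^sub>v col P j"
      using j r R(1)[OF x] P by (intro eq_vecI) auto
    moreover have "(Q * (\<rho> x * P)) $$ (i,j) = row Q i \<bullet> col (\<rho> x * P) j"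
      using i j r R(1)[OF x] P Q by (intro index_mult_mat(1)) auto
    moreover have "(Q *\<^sub>v (\<rho> x *\<^sub>v col P j)) $ i = row Q i \<bullet> (\<rho> x *\<^sub>v col P j)"
      using i Q by (intro index_mult_mat_vec) auto
    ultimately have "X x $$ (i,j) = (Q *\<^sub>v (\<rho> x *\<^sub>v col P j)) $ i"
      by (simp only:)
    then show ?thesis using QW[OF inv[OF x colP[OF j]] i] by simp
  qed
  have Xprod: "(X (x \<otimes> y)) $$ (i,j) = (\<Sum>k<n. X x $$ (i,k) * X y $$ (k,j))"
    if "x \<in> carrier G" "y \<in> carrier G" "i < n" "j < n" for x y i j
    using X[OF that(1)] X[OF that(2)] that(3,4)
    by (simp add: Xm[OF that(1,2)] scalar_prod_def lessThan_atLeast0)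
  define \<rho>1 where "\<rho>1 x = mat r r (\<lambda>(i,j). X x $$ (i,j))" for x
  define \<rho>2 where "\<rho>2 x = mat (n-r) (n-r) (\<lambda>(i,j). X x $$ (i+r,j+r))" for x
  have "\<rho>1 (x \<otimes> y) = \<rho>1 x * \<rho>1 y" if x: "x \<in> carrier G" and y: "y \<in> carrier G" for x y
  proof (rule eq_matI)
    fix i j assume "i < dim_row (\<rho>1 x * \<rho>1 y)" "j < dim_col (\<rho>1 x * \<rho>1 y)"
    then have ij: "i < r" "j < r" by (auto simp: \<rho>1_def)
    have "(\<Sum>k<n-r. X x $$ (i,k+r) * X y $$ (k+r,j)) = 0"
      using block[OF y] ij r by (intro sum.neutral) auto
    then show "\<rho>1 (x \<otimes> y) $$ (i,j) = (\<rho>1 x * \<rho>1 y) $$ (i,j)"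
      using ij r by (simp add: \<rho>1_def Xprod[OF x y] sum_lessThan_split[of r n] scalar_prod_def
          atLeast0LessThan)
  qed (auto simp: \<rho>1_def)
  then have rep1: "representation G r \<rho>1"
    using r X1 by (auto simp: representation_iff \<rho>1_def intro!: eq_matI)
  have "\<rho>2 (x \<otimes> y) = \<rho>2 x * \<rho>2 y" if x: "x \<in> carrier G" and y: "y \<in> carrier G" for x y
  proof (rule eq_matI)
    fix i j assume "i < dim_row (\<rho>2 x * \<rho>2 y)" "j < dim_col (\<rho>2 x * \<rho>2 y)"
    then have ij: "i < n-r" "j < n-r" by (auto simp: \<rho>2_def)
    have "(\<Sum>k<r. X x $$ (i+r,k) * X y $$ (k,j+r)) = 0"
      using block[OF x] ij r by (intro sum.neutral) auto
    then show "\<rho>2 (x \<otimes> y) $$ (i,j) = (\<rho>2 x * \<rho>2 y) $$ (i,j)"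
      using ij r by (simp add: \<rho>2_def Xprod[OF x y] sum_lessThan_split[of r n] scalar_prod_def
          atLeast0LessThan)
  qed (auto simp: \<rho>2_def)
  then have rep2: "representation G (n-r) \<rho>2"
    using r X1 by (auto simp: representation_iff \<rho>2_def intro!: eq_matI)
  have "mat_trace (\<rho> x) = mat_trace (\<rho>1 x) + mat_trace (\<rho>2 x)" if x: "x \<in> carrier G" for x
  proof -
    have "mat_trace (\<rho> x) = mat_trace (X x)"
      unfolding X_def using R(1)[OF x] P Q PQ by (intro mat_trace_conjugate[symmetric])
    also have "\<dots> = (\<Sum>i<n. X x $$ (i,i))" using X[OF x] by (simp add: mat_trace_def)
    also have "\<dots> = mat_trace (\<rho>1 x) + mat_trace (\<rho>2 x)"
      using r by (simp add: sum_lessThan_split[of r n] mat_trace_def \<rho>1_def \<rho>2_def)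
    finally show ?thesis .
  qed
  then show ?thesis using that r rep1 rep2 by blast
qed

lemma sum_mat_subgroup_absorbs:
  assumes rep: "representation G n \<rho>" and H: "subgroup H G" and y: "y \<in> H"
  shows "sum_mat n \<rho> H * \<rho> y = sum_mat n \<rho> H"
proof -
  note R = representationD[OF rep]
  interpret H: subgroup H G by (rule H)
  have RH: "\<rho> z \<in> carrier_mat n n" if "z \<in> H" for z using R(1) H.mem_carrier[OF that] .
  have bij: "bij_betw (\<lambda>z. z \<otimes> y) H H"
    by (rule bij_betw_byWitness[where f' = "\<lambda>z. z \<otimes> inv y"])
      (use y H.mem_carrier in \<open>auto simp: m_assoc\<close>)
  have "sum_mat n \<rho> H * \<rho> y = sum_mat n (\<lambda>z. \<rho> z * \<rho> y) H"
    using RH y by (intro sum_mat_mult) auto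
  also have "\<dots> = sum_mat n (\<lambda>z. \<rho> (z \<otimes> y)) H"
    using R(3) H.mem_carrier y by (intro sum_mat_cong) auto
  also have "\<dots> = sum_mat n \<rho> H" by (rule sum_mat_reindex[OF bij])
  finally show ?thesis .
qed

text \<open>
  As \<open>A\<close> is normal, the sum \<open>S\<close> over \<open>A\<close> commutes with the representation, so it is zero or injective.
  Right multiplication by \<open>\<rho> y\<close> with \<open>y \<in> A\<close> permutes the summands of \<open>S\<close>; when \<open>S\<close> is injective it
  can be cancelled from \<open>S \<rho>(y) = S\<close>.
\<close>
lemma irreducible_normal_sum:
  assumes irr: "irreducible_representation G n \<rho>" and A: "A \<lhd> G"
  shows "sum_mat n \<rho> A = 0\<^sub>m n n \<or> (\<forall>y\<in>A. \<rho> y = 1\<^sub>m n)"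
proof -
  have rep: "representation G n \<rho>" using irr by (simp add: irreducible_representation_def)
  note R = representationD[OF rep]
  interpret A: normal A G by (rule A)
  let ?S = "sum_mat n \<rho> A"
  have AG: "y \<in> carrier G" if "y \<in> A" for y using that by (rule A.mem_carrier)
  have RA: "\<rho> y \<in> carrier_mat n n" if "y \<in> A" for y using AG[OF that] R(1) by simp
  have comm: "?S * \<rho> x = \<rho> x * ?S" if x: "x \<in> carrier G" for x
  proof -
    have bij: "bij_betw (\<lambda>y. x \<otimes> y \<otimes> inv x) A A"
    proof (rule bij_betw_byWitness[where f' = "\<lambda>y. inv x \<otimes> y \<otimes> x"])
      show "\<forall>y\<in>A. inv x \<otimes> (x \<otimes> y \<otimes> inv x) \<otimes> x = y"
      proof
        fix y assume "y \<in> A"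
        then have y: "y \<in> carrier G" by (rule AG)
        have "inv x \<otimes> (x \<otimes> y \<otimes> inv x) \<otimes> x = (inv x \<otimes> x) \<otimes> y \<otimes> (inv x \<otimes> x)"
          using x y by (simp only: m_assoc m_closed inv_closed)
        then show "inv x \<otimes> (x \<otimes> y \<otimes> inv x) \<otimes> x = y" using x y by simp
      qed
      show "\<forall>y\<in>A. x \<otimes> (inv x \<otimes> y \<otimes> x) \<otimes> inv x = y"
      proof
        fix y assume "y \<in> A"
        then have y: "y \<in> carrier G" by (rule AG)
        have "x \<otimes> (inv x \<otimes> y \<otimes> x) \<otimes> inv x = (x \<otimes> inv x) \<otimes> y \<otimes> (x \<otimes> inv x)"
          using x y by (simp only: m_assoc m_closed inv_closed)
        then show "x \<otimes> (inv x \<otimes> y \<otimes> x) \<otimes> inv x = y" using x y by simp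
      qed
    qed (use x A.inv_op_closed1 A.inv_op_closed2 in auto)
    have "\<rho> x * ?S = sum_mat n (\<lambda>y. \<rho> x * \<rho> y) A"
      using R(1)[OF x] RA by (intro mult_sum_mat)
    also have "\<dots> = sum_mat n (\<lambda>y. \<rho> (x \<otimes> y \<otimes> inv x) * \<rho> x) A"
    proof (rule sum_mat_cong)
      fix y assume "y \<in> A"
      then have y: "y \<in> carrier G" by (rule AG)
      have "\<rho> x * \<rho> y = \<rho> (x \<otimes> y)" using R(3)[OF x y] by simp
      also have "x \<otimes> y = x \<otimes> y \<otimes> inv x \<otimes> x" using x y by (simp add: m_assoc)
      finally show "\<rho> x * \<rho> y = \<rho> (x \<otimes> y \<otimes> inv x) * \<rho> x" using x y by (simp add: R(3))
    qed
    also have "\<dots> = sum_mat n (\<lambda>y. \<rho> y * \<rho> x) A"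
      using sum_mat_reindex[OF bij, of n "\<lambda>y. \<rho> y * \<rho> x"] .
    also have "\<dots> = ?S * \<rho> x"
      using R(1)[OF x] RA by (intro sum_mat_mult[symmetric])
    finally show ?thesis by simp
  qed
  note absorb = sum_mat_subgroup_absorbs[OF rep A.is_subgroup]
  have "\<rho> y = 1\<^sub>m n" if inj: "\<forall>v\<in>carrier_vec n. ?S *\<^sub>v v = 0\<^sub>v n \<longrightarrow> v = 0\<^sub>v n" and y: "y \<in> A" for y
  proof (rule mat_eq_by_action)
    fix v :: "complex vec" assume v: "v \<in> carrier_vec n"
    have rv: "\<rho> y *\<^sub>v v \<in> carrier_vec n" using RA[OF y] v by auto
    have "?S *\<^sub>v (\<rho> y *\<^sub>v v - v) = ?S *\<^sub>v (\<rho> y *\<^sub>v v) - ?S *\<^sub>v v"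
      using rv v by (intro mult_minus_distrib_mat_vec[of _ n n]) auto
    also have "?S *\<^sub>v (\<rho> y *\<^sub>v v) = ?S * \<rho> y *\<^sub>v v"
      using RA[OF y] v by (intro assoc_mult_mat_vec[of _ n n _ n, symmetric]) auto
    also have "?S * \<rho> y *\<^sub>v v - ?S *\<^sub>v v = 0\<^sub>v n"
      unfolding absorb[OF y] by (rule minus_cancel_vec[OF mult_mat_vec_carrier[OF sum_mat_carrier v]])
    finally have "\<rho> y *\<^sub>v v - v = 0\<^sub>v n" using inj rv v by auto
    then have "(\<rho> y *\<^sub>v v) $ i = v $ i" if "i < n" for i
      using that rv v by (metis carrier_vecD eq_iff_diff_eq_0 index_minus_vec(1) index_zero_vec(1))
    then show "\<rho> y *\<^sub>v v = 1\<^sub>m n *\<^sub>v v" using rv v RA[OF y] by (intro eq_vecI) auto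
  qed (use RA[OF y] in auto)
  with intertwiner_zero_or_injective[OF irr sum_mat_carrier comm] show ?thesis by blast
qed

text \<open>
  If all irreducible representations that are not trivial on \<open>A\<close> have character \<open>\<chi>\<close>, then
  a composition series of \<open>\<rho>\<close> exhibits the character of \<open>\<rho>\<close>, minus its average over the cosets of \<open>A\<close>, as
  \<open>\<chi>\<close> times the number \<open>k\<close> of composition factors not trivial on \<open>A\<close>. The identity is scaled by
  \<open>card A\<close> to avoid fractions.
\<close>
lemma character_multiplicity:
  assumes fin: "finite (carrier G)" and A: "A \<lhd> G"
    and unique: "\<And>n \<rho> x. irreducible_representation G n \<rho> \<Longrightarrow>
      \<not> A \<subseteq> char_kernel G (rep_character G \<rho>) \<Longrightarrow> x \<in> carrier G \<Longrightarrow> mat_trace (\<rho> x) = \<chi> x"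
    and rep: "representation G n \<rho>"
  shows "\<exists>k::nat. \<forall>x\<in>carrier G. of_nat (card A) * mat_trace (\<rho> x)
           - (\<Sum>y\<in>A. mat_trace (\<rho> (x \<otimes> y))) = of_nat (card A) * of_nat k * \<chi> x"
  using rep
proof (induction n arbitrary: \<rho> rule: less_induct)
  case (less n)
  note R = representationD[OF less.prems]
  interpret A: normal A G by (rule A)
  have AG: "y \<in> carrier G" if "y \<in> A" for y using that by (rule A.mem_carrier)
  have finA: "finite A" using AG fin by (meson finite_subset subsetI)
  consider (zero) "n = 0" | (irr) "irreducible_representation G n \<rho>" |
    (red) "n > 0" "\<not> irreducible_representation G n \<rho>" by blast
  then show ?case
  proof cases
    case zero
    then have "mat_trace (\<rho> x) = 0" if "x \<in> carrier G" for x
      using R(1)[OF that] by (simp add: mat_trace_def)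
    then show ?thesis using AG by (intro exI[of _ 0]) auto
  next
    case irr
    then have n: "n > 0" by (simp add: irreducible_representation_def)
    from irreducible_normal_sum[OF irr A] show ?thesis
    proof
      assume triv: "\<forall>y\<in>A. \<rho> y = 1\<^sub>m n"
      have "(\<Sum>y\<in>A. mat_trace (\<rho> (x \<otimes> y))) = (\<Sum>y\<in>A. mat_trace (\<rho> x))" if x: "x \<in> carrier G" for x
        using triv R(1)[OF x] x AG by (intro sum.cong) (auto simp: R(3))
      then show ?thesis by (intro exI[of _ 0]) simp
    next
      assume S: "sum_mat n \<rho> A = 0\<^sub>m n n"
      have sum0: "(\<Sum>y\<in>A. mat_trace (\<rho> (x \<otimes> y))) = 0" if x: "x \<in> carrier G" for x
      proof -
        have "(\<Sum>y\<in>A. mat_trace (\<rho> (x \<otimes> y))) = (\<Sum>y\<in>A. mat_trace (\<rho> x * \<rho> y))"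
          using x AG by (intro sum.cong) (auto simp: R(3))
        also have "\<dots> = mat_trace (sum_mat n (\<lambda>y. \<rho> x * \<rho> y) A)"
          using R(1) x AG by (intro mat_trace_sum_mat[symmetric] mult_carrier_mat[of _ n n]) auto
        also have "\<dots> = mat_trace (\<rho> x * sum_mat n \<rho> A)"
          using R(1) x AG by (subst mult_sum_mat) auto
        also have "\<dots> = 0" unfolding S using R(1)[OF x] by (simp add: mat_trace_def)
        finally show ?thesis .
      qed
      \<comment> \<open>Otherwise the sum of the character over \<open>A\<close>, which is zero, would be \<open>card A * n\<close>.\<close>
      have "\<not> A \<subseteq> char_kernel G (rep_character G \<rho>)"
      proof
        assume K: "A \<subseteq> char_kernel G (rep_character G \<rho>)"
        have "(\<Sum>y\<in>A. mat_trace (\<rho> (\<one> \<otimes> y))) = (\<Sum>y\<in>A. of_nat n)"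
        proof (rule sum.cong)
          fix y assume y: "y \<in> A"
          then have "rep_character G \<rho> y = rep_character G \<rho> \<one>" using K by (auto simp: char_kernel_def)
          then show "mat_trace (\<rho> (\<one> \<otimes> y)) = of_nat n"
            using AG[OF y] R(2) by (simp add: rep_character_def mat_trace_def)
        qed simp
        then have "of_nat (card A) * of_nat n = (0::complex)" using sum0[of \<one>] by simp
        then show False using n finA A.one_closed by auto
      qed
      from unique[OF irr this] sum0 show ?thesis by (intro exI[of _ 1]) auto
    qed
  next
    case red
    then obtain W where W: "VectorSpace.subspace class_ring W (module_vec TYPE(complex) n)"
      "\<And>x w. x \<in> carrier G \<Longrightarrow> w \<in> W \<Longrightarrow> \<rho> x *\<^sub>v w \<in> W" "W \<noteq> {0\<^sub>v n}" "W \<noteq> carrier_vec n"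
      using less.prems unfolding irreducible_representation_def by blast
    obtain r \<rho>1 \<rho>2 where r: "0 < r" "r < n" and reps: "representation G r \<rho>1" "representation G (n-r) \<rho>2"
      and tr: "\<And>x. x \<in> carrier G \<Longrightarrow> mat_trace (\<rho> x) = mat_trace (\<rho>1 x) + mat_trace (\<rho>2 x)"
      using invariant_subspace_splits_trace[OF less.prems W] by metis
    obtain k1 :: nat where k1: "\<forall>x\<in>carrier G. of_nat (card A) * mat_trace (\<rho>1 x)
           - (\<Sum>y\<in>A. mat_trace (\<rho>1 (x \<otimes> y))) = of_nat (card A) * of_nat k1 * \<chi> x"
      using less.IH[OF r(2) reps(1)] by blast
    obtain k2 :: nat where k2: "\<forall>x\<in>carrier G. of_nat (card A) * mat_trace (\<rho>2 x)
           - (\<Sum>y\<in>A. mat_trace (\<rho>2 (x \<otimes> y))) = of_nat (card A) * of_nat k2 * \<chi> x"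
      using less.IH[OF _ reps(2)] r by auto
    show ?thesis
    proof (intro exI ballI)
      fix x assume x: "x \<in> carrier G"
      have "(\<Sum>y\<in>A. mat_trace (\<rho> (x \<otimes> y)))
          = (\<Sum>y\<in>A. mat_trace (\<rho>1 (x \<otimes> y))) + (\<Sum>y\<in>A. mat_trace (\<rho>2 (x \<otimes> y)))"
        unfolding sum.distrib[symmetric] using x AG by (intro sum.cong) (auto simp: tr)
      then show "of_nat (card A) * mat_trace (\<rho> x) - (\<Sum>y\<in>A. mat_trace (\<rho> (x \<otimes> y)))
          = of_nat (card A) * of_nat (k1 + k2) * \<chi> x"
        using bspec[OF k1 x] bspec[OF k2 x] tr[OF x] by (simp add: algebra_simps)
    qed
  qed
qed

text \<open>
  Left multiplication permutes the group without fixed points, except by the identity.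
\<close>
lemma regular_representation_exists:
  assumes fin: "finite (carrier G)"
  obtains \<rho> where "representation G (Coset.order G) \<rho>"
    "\<And>x. x \<in> carrier G \<Longrightarrow> mat_trace (\<rho> x) = (if x = \<one> then of_nat (Coset.order G) else 0)"
proof -
  define q where "q = Coset.order G"
  obtain e where e: "bij_betw e {..<q} (carrier G)"
    using ex_bij_betw_nat_finite[OF fin] by (auto simp: q_def Coset.order_def atLeast0LessThan)
  have ec: "e i \<in> carrier G" if "i < q" for i using e that by (auto simp: bij_betw_def)
  have einj: "e i = e j \<longleftrightarrow> i = j" if "i < q" "j < q" for i j
    using e that by (auto simp: bij_betw_def inj_on_def)
  define \<rho> :: "'a \<Rightarrow> complex mat" where
    "\<rho> x = mat q q (\<lambda>(i,j). if x \<otimes> e j = e i then 1 else 0)" for x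
  have "\<rho> (x \<otimes> y) = \<rho> x * \<rho> y" if x: "x \<in> carrier G" and y: "y \<in> carrier G" for x y
  proof (rule eq_matI)
    fix i j assume "i < dim_row (\<rho> x * \<rho> y)" "j < dim_col (\<rho> x * \<rho> y)"
    then have ij: "i < q" "j < q" by (auto simp: \<rho>_def)
    have "(\<rho> x * \<rho> y) $$ (i,j)
        = (\<Sum>k<q. (if x \<otimes> e k = e i then 1 else 0) * (if y \<otimes> e j = e k then 1 else 0))"
      using ij by (simp add: \<rho>_def scalar_prod_def lessThan_atLeast0)
    also have "\<dots> = (\<Sum>z\<in>carrier G. (if x \<otimes> z = e i then 1 else 0) * (if y \<otimes> e j = z then 1 else 0))"
      by (rule sum.reindex_bij_betw[OF e])
    also have "\<dots> = (\<Sum>z\<in>carrier G. if z = y \<otimes> e j then (if x \<otimes> (y \<otimes> e j) = e i then 1 else 0) else 0)"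
      by (intro sum.cong) auto
    also have "\<dots> = \<rho> (x \<otimes> y) $$ (i,j)"
      using ij x y ec fin by (simp add: \<rho>_def m_assoc)
    finally show "\<rho> (x \<otimes> y) $$ (i,j) = (\<rho> x * \<rho> y) $$ (i,j)" by simp
  qed (auto simp: \<rho>_def)
  moreover have "\<rho> \<one> = 1\<^sub>m q" using ec einj by (auto simp: \<rho>_def intro!: eq_matI)
  ultimately have "representation G q \<rho>" by (auto simp: representation_iff \<rho>_def)
  moreover have "mat_trace (\<rho> x) = (if x = \<one> then of_nat q else 0)" if x: "x \<in> carrier G" for x
  proof -
    have "mat_trace (\<rho> x) = (\<Sum>i<q. if x = \<one> then 1 else 0)"
      unfolding mat_trace_def using x ec by (auto simp: \<rho>_def intro!: sum.cong)
    then show ?thesis by simp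
  qed
  ultimately show ?thesis using that unfolding q_def by blast
qed


section \<open>Degrees, conjugacy classes and elements of prime order\<close>

text \<open>
  The average of \<open>\<rho>\<close> over \<open>H\<close> is idempotent, so its trace is a natural number (the dimension of the
  space fixed by \<open>H\<close>). When the character vanishes off \<open>\<one>\<close> that trace is \<open>n / |H|\<close>.
\<close>
lemma subgroup_order_dvd_degree:
  assumes rep: "representation G n \<rho>" and H: "subgroup H G" and fin: "finite H"
    and vanish: "\<And>h. h \<in> H \<Longrightarrow> h \<noteq> \<one> \<Longrightarrow> mat_trace (\<rho> h) = 0"
  shows "card H dvd n"
proof -
  note R = representationD[OF rep]
  interpret H: subgroup H G by (rule H)
  have RH: "\<rho> z \<in> carrier_mat n n" if "z \<in> H" for z using R(1) H.mem_carrier[OF that] .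
  define h :: complex where "h = of_nat (card H)"
  have "card H \<noteq> 0" using fin H.one_closed by (metis card_0_eq empty_iff)
  then have h: "h \<noteq> 0" by (simp add: h_def)
  define S where "S = sum_mat n \<rho> H"
  have S: "S \<in> carrier_mat n n" by (simp add: S_def)
  have "S * S = sum_mat n (\<lambda>y. S * \<rho> y) H"
    unfolding S_def using RH by (intro mult_sum_mat) auto
  also have "\<dots> = sum_mat n (\<lambda>y. S) H"
    by (intro sum_mat_cong) (auto simp: S_def sum_mat_subgroup_absorbs[OF rep H])
  finally have SS: "S * S = h \<cdot>\<^sub>m S" using S by (simp add: sum_mat_const h_def)
  define P where "P = (1/h) \<cdot>\<^sub>m S"
  have P: "P \<in> carrier_mat n n" using S by (simp add: P_def)
  have "P * P = (1/h) \<cdot>\<^sub>m ((1/h) \<cdot>\<^sub>m (S * S))"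
    unfolding P_def using S
    by (simp add: mult_smult_assoc_mat[of S n n _ n] mult_smult_distrib[of S n n S n])
  also have "\<dots> = P" unfolding SS P_def using S h by (auto intro!: eq_matI)
  finally have "P * P = P" .
  then obtain k :: nat where k: "mat_trace P = of_nat k" using mat_trace_idempotent[OF P] by blast
  have "mat_trace S = (\<Sum>y\<in>H. mat_trace (\<rho> y))" unfolding S_def using RH by (rule mat_trace_sum_mat)
  also have "\<dots> = (\<Sum>y\<in>{\<one>}. mat_trace (\<rho> y))"
    using fin vanish by (intro sum.mono_neutral_right) auto
  also have "\<dots> = of_nat n" by (simp add: R(2) mat_trace_def)
  finally have "mat_trace P = of_nat n / h"
    using S by (simp add: P_def mat_trace_def flip: sum_divide_distrib)
  then have "of_nat n = (of_nat (card H * k) :: complex)" using k h by (simp add: h_def field_simps)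
  then have "n = card H * k" by (simp only: of_nat_eq_iff)
  then show ?thesis by simp
qed

lemma card_conj_class_centralizer:
  assumes x: "x \<in> carrier G"
  shows "card (conj_class G x) * card (centralizer G x) = Coset.order G"
proof -
  let ?\<phi> = "\<lambda>g. \<lambda>h\<in>carrier G. g \<otimes> h \<otimes> inv g"
  interpret act: group_action G "carrier G" ?\<phi> by (rule action_by_conjugation)
  have "orbit G ?\<phi> x = conj_class G x"
    using x by (auto simp: orbit_def conj_class_def)
  moreover have "stabilizer G ?\<phi> x = centralizer G x"
  proof -
    have "g \<otimes> x \<otimes> inv g = x \<longleftrightarrow> g \<otimes> x = x \<otimes> g" if "g \<in> carrier G" for g
      using that x by (metis inv_solve_right m_closed)
    then show ?thesis using x by (auto simp: stabilizer_def centralizer_def)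
  qed
  ultimately show ?thesis using act.orbit_stabilizer_theorem[OF x] by simp
qed

lemma conj_pow:
  assumes "h \<in> carrier G" "x \<in> carrier G"
  shows "(h \<otimes> x \<otimes> inv h) [^] (n::nat) = h \<otimes> x [^] n \<otimes> inv h"
proof (induction n)
  case (Suc n)
  have "(h \<otimes> x \<otimes> inv h) [^] Suc n = h \<otimes> x [^] n \<otimes> (inv h \<otimes> h) \<otimes> x \<otimes> inv h"
    unfolding nat_pow_Suc Suc using assms by (simp only: m_assoc m_closed inv_closed nat_pow_closed)
  also have "\<dots> = h \<otimes> x [^] Suc n \<otimes> inv h" using assms by (simp add: m_assoc)
  finally show ?case .
qed (use assms in simp)

lemma cauchy:
  assumes fin: "finite (carrier G)" and p: "prime p" "p dvd Coset.order G"
  obtains x where "x \<in> carrier G" "x \<noteq> \<one>" "x [^] p = \<one>"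
proof -
  obtain m where "Coset.order G = p ^ 1 * m" using p(2) by (auto simp: dvd_def)
  from sylow_thm[OF p(1) is_group this fin] obtain H where H: "subgroup H G" "card H = p"
    by auto
  interpret H: subgroup H G by (rule H)
  have "H \<noteq> {\<one>}" using H(2) p(1) by (auto simp: prime_nat_iff)
  then obtain x where x: "x \<in> H" "x \<noteq> \<one>" using H.one_closed by blast
  interpret HG: group "G\<lparr>carrier := H\<rparr>" using H.subgroup_is_group[OF is_group] .
  have "x [^]\<^bsub>G\<lparr>carrier := H\<rparr>\<^esub> p = \<one>"
    using HG.pow_order_eq_1[of x] x H(2) by (simp add: Coset.order_def)
  then have "x [^] p = \<one>" by (simp add: nat_pow_consistent[symmetric])
  then show ?thesis using that x H.mem_carrier by blast
qed

text \<open>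
  If the primes \<open>p\<close> and \<open>r\<close> divide \<open>|A|\<close>, then \<open>A\<close> has elements of both orders by Cauchy's theorem; both
  are conjugate to \<open>g\<close>, so the order of \<open>g\<close> divides \<open>p\<close> and \<open>r\<close>, which forces \<open>p = r\<close>.
\<close>
lemma transitive_subgroup_prime_power:
  assumes fin: "finite (carrier G)" and A: "subgroup A G" and g: "g \<in> A"
    and trans: "conj_class G g = A - {\<one>}"
  obtains p k where "prime p" "k > 0" "card A = p ^ k"
proof -
  interpret A: subgroup A G by (rule A)
  interpret AG: group "G\<lparr>carrier := A\<rparr>" using A.subgroup_is_group[OF is_group] .
  have gG: "g \<in> carrier G" using A.mem_carrier[OF g] .
  have finA: "finite A" using fin A.subset finite_subset by blast
  have "\<one> \<otimes> g \<otimes> inv \<one> \<in> conj_class G g" unfolding conj_class_def by blast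
  then have g1: "g \<noteq> \<one>" using gG trans by auto
  \<comment> \<open>An element of order \<open>r\<close> in \<open>A\<close> is conjugate to \<open>g\<close>.\<close>
  have gpow: "g [^] r = \<one>" if r: "prime r" "r dvd card A" for r :: nat
  proof -
    obtain x where x: "x \<in> A" "x \<noteq> \<one>" "x [^] r = \<one>"
      using AG.cauchy[of r] finA r by (auto simp: Coset.order_def nat_pow_consistent[symmetric])
    then obtain h where h: "h \<in> carrier G" "x = h \<otimes> g \<otimes> inv h"
      using trans by (auto simp: conj_class_def)
    have "h \<otimes> g [^] r \<otimes> inv h = \<one>" using x(3) h gG by (simp add: conj_pow)
    moreover have "inv h \<otimes> (h \<otimes> g [^] r \<otimes> inv h) \<otimes> h = (inv h \<otimes> h) \<otimes> g [^] r \<otimes> (inv h \<otimes> h)"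
      using h(1) gG by (simp only: m_assoc m_closed inv_closed nat_pow_closed)
    ultimately show ?thesis using h(1) gG by simp
  qed
  have "card A \<noteq> 1" using g g1 A.one_closed by (auto simp: card_1_singleton_iff)
  then obtain p where p: "prime p" "p dvd card A" using prime_factor_nat by blast
  have only: "r = p" if r: "prime r" "r dvd card A" for r
  proof (rule ccontr)
    assume "r \<noteq> p"
    then have "coprime r p" using r p primes_coprime by blast
    moreover have "ord g dvd r" "ord g dvd p" using gpow r p gG by (auto simp: pow_eq_id[symmetric])
    ultimately have "ord g = 1" by (metis coprime_common_divisor_nat)
    then show False using pow_ord_eq_1[OF gG] g1 gG by simp
  qed
  have "card A \<noteq> 0" using finA g by auto
  then obtain u where u: "card A = p ^ multiplicity p (card A) * u" "\<not> p dvd u"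
    using multiplicity_decompose'[of "card A" p] p(1) by (metis not_prime_unit)
  have "u = 1"
  proof (rule ccontr)
    assume "u \<noteq> 1"
    then obtain r where "prime r" "r dvd u" using prime_factor_nat by blast
    then show False using only[of r] u by (metis dvd_mult)
  qed
  then have "card A = p ^ multiplicity p (card A)" using u by simp
  moreover have "multiplicity p (card A) > 0"
    using calculation \<open>card A \<noteq> 1\<close> by (metis gr0I power_0)
  ultimately show ?thesis using that p by blast
qed

section \<open>The values of the sole character\<close>

text \<open>
  The multiple \<open>k\<chi>\<close> obtained from the regular representation is the class function \<open>f\<close> of the proof.
  Its value at \<open>\<one>\<close> gives \<open>kd = m(a - 1)\<close> and its norm gives \<open>k\<^sup>2 = m(a - 1)\<close>, where \<open>a = |A|\<close>; so \<open>k = d\<close>.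
  The representation is kept in the conclusion because its restriction to Sylow subgroups
  is needed later.
\<close>
lemma sole_character_values:
  assumes fin: "finite (carrier G)" and A: "A \<lhd> G" and nontriv: "A \<noteq> {\<one>}"
    and sole: "Irr_over G A = {\<chi>}"
  obtains d m \<rho> where "d > 0" "Coset.order G = m * card A" "d\<^sup>2 = m * (card A - 1)" "card A > 1"
    "representation G d \<rho>" "\<And>x. x \<in> carrier G \<Longrightarrow> \<chi> x = mat_trace (\<rho> x)"
    "\<chi> \<one> = of_nat d" "\<And>x. x \<in> A \<Longrightarrow> x \<noteq> \<one> \<Longrightarrow> \<chi> x = - (of_nat m / of_nat d)"
    "\<And>x. x \<in> carrier G \<Longrightarrow> x \<notin> A \<Longrightarrow> \<chi> x = 0"
proof -
  interpret A: normal A G by (rule A)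
  have AG: "y \<in> carrier G" if "y \<in> A" for y using that by (rule A.mem_carrier)
  have finA: "finite A" using AG fin by (meson finite_subset subsetI)
  define q where "q = Coset.order G"
  define a where "a = card A"
  define m where "m = card (rcosets A)"
  have q: "q = m * a" unfolding q_def a_def m_def using lagrange[OF A.is_subgroup] by simp
  have q0: "q > 0" using fin by (simp add: q_def order_gt_0_iff_finite)
  have a1: "a > 1"
  proof -
    obtain y where "y \<in> A" "y \<noteq> \<one>" using nontriv A.one_closed by blast
    then have "card {\<one>, y} \<le> card A" using finA A.one_closed by (intro card_mono) auto
    then show ?thesis using \<open>y \<noteq> \<one>\<close> by (simp add: a_def)
  qed
  have m0: "m > 0" using q q0 by (cases m) auto
  have "\<chi> \<in> Irr G" using sole by (auto simp: Irr_over_def)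
  then obtain d \<rho> where irr: "irreducible_representation G d \<rho>" and \<chi>: "\<chi> = rep_character G \<rho>"
    by (auto simp: Irr_def)
  have rep: "representation G d \<rho>" and d: "d > 0" using irr by (auto simp: irreducible_representation_def)
  note R = representationD[OF rep]
  have tr: "\<chi> x = mat_trace (\<rho> x)" if "x \<in> carrier G" for x using that by (simp add: \<chi> rep_character_def)
  have \<chi>1: "\<chi> \<one> = of_nat d" using R(2) by (simp add: tr mat_trace_def)
  have unique: "mat_trace (\<sigma> x) = \<chi> x" if "irreducible_representation G n \<sigma>"
      "\<not> A \<subseteq> char_kernel G (rep_character G \<sigma>)" "x \<in> carrier G" for n \<sigma> x
  proof -
    have "rep_character G \<sigma> \<in> Irr_over G A" using that by (auto simp: Irr_over_def Irr_def)
    then have "rep_character G \<sigma> = \<chi>" using sole by simp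
    then show ?thesis using that(3) by (auto simp: rep_character_def)
  qed
  obtain reg where reg: "representation G q reg"
    and regtr: "\<And>x. x \<in> carrier G \<Longrightarrow> mat_trace (reg x) = (if x = \<one> then of_nat q else 0)"
    using regular_representation_exists[OF fin] unfolding q_def by blast
  obtain k :: nat where k: "\<And>x. x \<in> carrier G \<Longrightarrow> of_nat a * mat_trace (reg x)
           - (\<Sum>y\<in>A. mat_trace (reg (x \<otimes> y))) = of_nat a * of_nat k * \<chi> x"
    using character_multiplicity[where \<chi> = \<chi> and A = A and n = q and \<rho> = reg, OF fin A _ reg] unique
    unfolding a_def by blast
  \<comment> \<open>The difference of the regular characters of \<open>G\<close> and of \<open>G/A\<close>.\<close>
  define f :: "'a \<Rightarrow> complex" where
    "f x = (if x = \<one> then of_nat (m * (a - 1)) else if x \<in> A then - of_nat m else 0)" for x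
  have kf: "of_nat k * \<chi> x = f x" if x: "x \<in> carrier G" for x
  proof -
    have "(\<Sum>y\<in>A. mat_trace (reg (x \<otimes> y))) = (\<Sum>y\<in>A. if y = inv x then of_nat q else 0)"
      using x AG by (intro sum.cong) (auto simp: regtr inv_solve_left' intro: inv_equality[symmetric]
          dest: inv_equality)
    also have "\<dots> = (if x \<in> A then of_nat q else 0)"
      using finA x A.m_inv_closed[of "inv x"] A.m_inv_closed[of x] by auto
    finally have "of_nat a * (of_nat k * \<chi> x)
        = of_nat a * mat_trace (reg x) - (if x \<in> A then of_nat q else 0)"
      using k[OF x] by (simp only: mult.assoc)
    also have "\<dots> = of_nat a * (mat_trace (reg x) - (if x \<in> A then of_nat m else 0))"
      by (simp add: q algebra_simps)
    finally have "of_nat k * \<chi> x = mat_trace (reg x) - (if x \<in> A then of_nat m else 0)"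
      using a1 by simp
    then show ?thesis
      using x a1 A.one_closed by (auto simp: regtr f_def q of_nat_diff right_diff_distrib)
  qed
  have fval: "of_nat k * of_nat d = (of_nat (m * (a - 1)) :: complex)"
    using kf[of \<one>] by (simp add: \<chi>1 f_def)
  then have kd: "k * d = m * (a - 1)" by (simp only: of_nat_mult[symmetric] of_nat_eq_iff)
  have f_inv: "f (inv x) = f x" if "x \<in> carrier G" for x
  proof -
    have "inv x \<in> A \<longleftrightarrow> x \<in> A" using A.m_inv_closed[of x] A.m_inv_closed[of "inv x"] that by auto
    then show ?thesis using that by (auto simp: f_def inv_eq_1_iff)
  qed
  \<comment> \<open>The norm of \<open>k\<chi> = f\<close>, computed once from the norm of \<open>\<chi>\<close> and once from the values of \<open>f\<close>.\<close>
  have "of_nat k ^ 2 * of_nat q = (\<Sum>x\<in>carrier G. (of_nat k * \<chi> x) * (of_nat k * \<chi> (inv x)))"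
    using irreducible_character_norm[OF irr]
    by (simp add: tr q_def[symmetric] sum_distrib_left[symmetric] power2_eq_square algebra_simps
        flip: sum_distrib_left)
  also have "\<dots> = (\<Sum>x\<in>carrier G. f x ^ 2)"
    by (intro sum.cong) (auto simp: kf f_inv power2_eq_square)
  also have "\<dots> = (\<Sum>x\<in>A. f x ^ 2)"
    using fin AG A.one_closed by (intro sum.mono_neutral_right) (auto simp: f_def)
  also have "\<dots> = f \<one> ^ 2 + (\<Sum>x\<in>A-{\<one>}. f x ^ 2)"
    by (rule sum.remove[OF finA A.one_closed])
  also have "(\<Sum>x\<in>A-{\<one>}. f x ^ 2) = (\<Sum>x\<in>A-{\<one>}. of_nat (m ^ 2))"
    by (intro sum.cong) (auto simp: f_def)
  also have "\<dots> = of_nat ((a - 1) * m ^ 2)"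
    using A.one_closed finA by (simp add: a_def)
  also have "f \<one> ^ 2 = of_nat ((m * (a - 1)) ^ 2)" by (simp add: f_def)
  finally have "of_nat (k ^ 2 * q) = (of_nat ((m * (a - 1)) ^ 2 + (a - 1) * m ^ 2) :: complex)" by simp
  then have "k ^ 2 * q = (m * (a - 1)) ^ 2 + (a - 1) * m ^ 2" by (simp only: of_nat_eq_iff)
  also have "\<dots> = m * (a - 1) * (m * (a - 1 + 1))" by (simp add: power2_eq_square algebra_simps)
  also have "m * (a - 1 + 1) = q" using a1 by (simp add: q)
  finally have k2: "k ^ 2 = m * (a - 1)" using q0 by simp
  have "k > 0" using kd m0 a1 by (cases k) auto
  have "k * d = k * k" using kd k2 by (simp add: power2_eq_square)
  then have "k = d" using \<open>k > 0\<close> by simp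
  show ?thesis
  proof (rule that[of d m \<rho>])
    show "d\<^sup>2 = m * (card A - 1)" using k2 \<open>k = d\<close> by (simp add: a_def)
    show "\<chi> x = - (of_nat m / of_nat d)" if "x \<in> A" "x \<noteq> \<one>" for x
      using kf[OF AG[OF that(1)]] that d by (simp add: f_def \<open>k = d\<close> field_simps)
    show "\<chi> x = 0" if "x \<in> carrier G" "x \<notin> A" for x
    proof -
      have "x \<noteq> \<one>" using that(2) A.one_closed by metis
      then show ?thesis using kf[OF that(1)] that d by (simp add: f_def \<open>k = d\<close>)
    qed
  qed (use d q a1 rep tr \<chi>1 in \<open>auto simp: q_def a_def\<close>)
qed

end

section \<open>The prime power structure\<close>

text \<open>
  Write \<open>m = p\<^sup>e u\<close> with \<open>u\<close> prime to \<open>p\<close>. Since \<open>a\<close> is a power of \<open>p\<close>, \<open>a - 1\<close> is prime to \<open>p\<close>, and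
  since it divides \<open>ma\<close> it divides \<open>u\<close>. For a prime \<open>r \<noteq> p\<close> with \<open>r\<^sup>t\<close> exactly dividing \<open>u\<close>, also \<open>r\<^sup>t\<close> divides \<open>d\<close>, so
  \<open>r\<close> divides \<open>d\<^sup>2 = m(a - 1)\<close> at least \<open>2t\<close> times, at least \<open>t\<close> of them in \<open>a - 1\<close>. Thus \<open>u = a - 1\<close>.
\<close>
lemma prime_power_shape:
  fixes p a m q d :: nat
  assumes p: "prime p" and a: "a = p ^ k" "a > 1" and m: "m > 0" and d: "d\<^sup>2 = m * (a - 1)"
    and cls: "a - 1 dvd m * a"
    and sylow: "\<And>r. prime r \<Longrightarrow> r \<noteq> p \<Longrightarrow> r ^ multiplicity r (m * a) dvd d"
  shows "m = p_part p m * (a - 1)" "p'_part p m = a - 1" "p_part p (m * a) = p_part p m * a"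
proof -
  have k: "k > 0" using a by (cases k) auto
  define e where "e = multiplicity p m"
  obtain u where u: "m = p ^ e * u" "\<not> p dvd u"
    using multiplicity_decompose'[of m p] m p unfolding e_def by (metis not_prime_unit less_irrefl)
  have u0: "u > 0" using u m by (cases u) auto
  have pa: "p dvd a" using a k by simp
  have npa: "\<not> p dvd a - 1"
  proof
    assume "p dvd a - 1"
    then have "p dvd a - (a - 1)" by (rule dvd_diff_nat[OF pa])
    moreover have "a - (a - 1) = 1" using a by simp
    ultimately show False using p by (metis not_prime_unit)
  qed
  have cop: "coprime (a - 1) p" using npa p by (metis coprime_commute prime_imp_coprime)
  have "a - 1 dvd p ^ (e + k) * u" using cls u a by (simp add: power_add algebra_simps)
  moreover have "coprime (a - 1) (p ^ (e + k))" using cop by simp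
  ultimately have "a - 1 dvd u" by (simp add: coprime_dvd_mult_right_iff)
  moreover have "u dvd a - 1"
  proof (rule multiplicity_le_imp_dvd)
    show "u \<noteq> 0" using u0 by simp
    fix r :: nat assume r: "prime r"
    show "multiplicity r u \<le> multiplicity r (a - 1)"
    proof (cases "r = p")
      case True
      then show ?thesis using u by (simp add: not_dvd_imp_multiplicity_0)
    next
      case False
      then have nr: "\<not> r dvd p ^ j" for j
        using r p by (metis prime_dvd_power primes_dvd_imp_eq)
      define t where "t = multiplicity r u"
      have d0: "d \<noteq> 0" using d m a by (metis less_numeral_extra(3) mult_is_0 zero_eq_power2 zero_less_diff)
      have pe: "prime_elem r" using r by simp
      have mm: "multiplicity r m = t"
        using u0 u(1) p nr[of e] by (simp add: prime_elem_multiplicity_mult_distrib[OF pe] t_def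
            not_dvd_imp_multiplicity_0)
      have "multiplicity r (m * a) = t"
        using m a p nr[of k] by (simp add: prime_elem_multiplicity_mult_distrib[OF pe] mm
            not_dvd_imp_multiplicity_0)
      then have "r ^ t dvd d" using sylow[OF r False] by simp
      then have "t \<le> multiplicity r d" using d0 r by (intro multiplicity_geI) auto
      then have "2 * t \<le> multiplicity r (d\<^sup>2)"
        using d0 by (simp add: prime_elem_multiplicity_power_distrib[OF pe])
      also have "\<dots> = t + multiplicity r (a - 1)"
        unfolding d using m a by (simp add: prime_elem_multiplicity_mult_distrib[OF pe] mm)
      finally show ?thesis by (simp add: t_def)
    qed
  qed
  ultimately have ua: "u = a - 1" by (rule dvd_antisym[rotated])
  have part: "p_part p m = p ^ e" by (simp add: p_part_def e_def)
  show "m = p_part p m * (a - 1)" using u ua part by simp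
  then show "p'_part p m = a - 1"
    using part p unfolding p'_part_def
    by (metis nonzero_mult_div_cancel_left power_not_zero not_prime_0)
  have "multiplicity p (m * a) = e + k"
    using m a p by (simp add: prime_elem_multiplicity_mult_distrib e_def)
  then show "p_part p (m * a) = p_part p m * a"
    using a part by (simp add: p_part_def power_add)
qed

context group
begin

text \<open>
  This is the theorem in the case \<open>N = 1\<close>, with the data from which all orders and values can be
  read off. A Sylow subgroup for a prime other than \<open>p\<close> meets the \<open>p\<close>-group \<open>A\<close> only in \<open>\<one>\<close>, so \<open>\<chi>\<close>
  vanishes on its other elements and its order divides the degree; the class of \<open>g\<close> has \<open>|A| - 1\<close>
  elements. These are the two divisibilities for \<open>prime_power_shape\<close>.
\<close>
lemma sole_character_of_transitive_normal_subgroup: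
  assumes fin: "finite (carrier G)" and A: "A \<lhd> G" and g: "g \<in> A"
    and trans: "conj_class G g = A - {\<one>}" and sole: "Irr_over G A = {\<chi>}"
  obtains p m d where "prime p" "d > 0" "m > 0" "card A > 1" "Coset.order G = m * card A" "d\<^sup>2 = m * (card A - 1)"
    "m = p_part p m * (card A - 1)" "p'_part p m = card A - 1"
    "p_part p (Coset.order G) = p_part p m * card A" "\<exists>k. card A = p ^ k"
    "\<chi> \<one> = of_nat d" "\<And>x. x \<in> A \<Longrightarrow> x \<noteq> \<one> \<Longrightarrow> \<chi> x = - (of_nat m / of_nat d)"
    "\<And>x. x \<in> carrier G \<Longrightarrow> x \<notin> A \<Longrightarrow> \<chi> x = 0"
proof -
  interpret A: normal A G by (rule A)
  have AG: "y \<in> carrier G" if "y \<in> A" for y using that by (rule A.mem_carrier)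
  have finA: "finite A" using AG fin by (meson finite_subset subsetI)
  have gG: "g \<in> carrier G" using AG[OF g] .
  have "\<one> \<otimes> g \<otimes> inv \<one> \<in> conj_class G g" unfolding conj_class_def by blast
  then have nontriv: "A \<noteq> {\<one>}" using gG trans by auto
  obtain d m \<rho> where d: "d > 0" and q: "Coset.order G = m * card A" and d2: "d\<^sup>2 = m * (card A - 1)"
    and a1: "card A > 1" and rep: "representation G d \<rho>"
    and tr: "\<And>x. x \<in> carrier G \<Longrightarrow> \<chi> x = mat_trace (\<rho> x)"
    and vals: "\<chi> \<one> = of_nat d" "\<And>x. x \<in> A \<Longrightarrow> x \<noteq> \<one> \<Longrightarrow> \<chi> x = - (of_nat m / of_nat d)"
    "\<And>x. x \<in> carrier G \<Longrightarrow> x \<notin> A \<Longrightarrow> \<chi> x = 0"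
    using sole_character_values[OF fin A nontriv sole] by blast
  obtain p k where p: "prime p" and k: "card A = p ^ k"
    using transitive_subgroup_prime_power[OF fin A.is_subgroup g trans] by blast
  have q0: "Coset.order G > 0" using fin by (simp add: order_gt_0_iff_finite)
  then have m: "m > 0" using q by (cases m) auto
  have "card (conj_class G g) = card A - 1" unfolding trans using finA A.one_closed by simp
  then have cls: "card A - 1 dvd m * card A"
    using card_conj_class_centralizer[OF gG] q by (metis dvd_triv_left)
  have sylow: "r ^ multiplicity r (m * card A) dvd d" if r: "prime r" "r \<noteq> p" for r
  proof -
    have "r ^ multiplicity r (m * card A) dvd Coset.order G" unfolding q by (rule multiplicity_dvd)
    then obtain l where "Coset.order G = r ^ multiplicity r (m * card A) * l" by (auto simp: dvd_def)
    from sylow_thm[OF r(1) is_group this fin] obtain H where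
      H: "subgroup H G" "card H = r ^ multiplicity r (m * card A)" by blast
    have "mat_trace (\<rho> h) = 0" if h: "h \<in> H" "h \<noteq> \<one>" for h
    proof -
      have hG: "h \<in> carrier G" using H(1) h(1) subgroup.mem_carrier by metis
      have "h \<notin> A"
      proof
        assume "h \<in> A"
        have fixed: "h [^] card K = \<one>" if K: "subgroup K G" "h \<in> K" for K
        proof -
          interpret K: subgroup K G by (rule K(1))
          interpret KG: group "G\<lparr>carrier := K\<rparr>" using K.subgroup_is_group[OF is_group] .
          show ?thesis using KG.pow_order_eq_1[of h] K(2)
            by (simp add: Coset.order_def nat_pow_consistent[symmetric])
        qed
        have "ord h dvd card H" "ord h dvd card A"
          using fixed[OF H(1) h(1)] fixed[OF A.is_subgroup \<open>h \<in> A\<close>] hG by (simp_all add: pow_eq_id)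
        moreover have "coprime (card H) (card A)"
          unfolding H(2) k using r p by (simp add: primes_coprime)
        ultimately have "ord h = 1" by (metis coprime_common_divisor_nat)
        then show False using pow_ord_eq_1[OF hG] h(2) hG by simp
      qed
      then show ?thesis using vals(3)[OF hG] tr[OF hG] by simp
    qed
    moreover have "finite H" using H(1) fin by (meson finite_subset subgroup.subset)
    ultimately show ?thesis using subgroup_order_dvd_degree[OF rep H(1)] H(2) by metis
  qed
  note shape = prime_power_shape[OF p k a1 m d2 cls sylow]
  show ?thesis
  proof (rule that[of p d m])
    show "p_part p (Coset.order G) = p_part p m * card A" using shape(3) q by simp
  qed (use p d m a1 q d2 shape(1,2) vals k in auto)
qed

end

section \<open>The theorem for a quotient group\<close>

context normal
begin

lemma conj_class_FactGroup:
  assumes g: "g \<in> carrier G"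
  shows "conj_class (G Mod H) (H #> g) = (\<lambda>x. H #> x) ` conj_class G g"
proof -
  interpret Q: group "G Mod H" by (rule factorgroup_is_group)
  interpret hom: group_hom G "G Mod H" "\<lambda>x. H #> x"
    using r_coset_hom_Mod by unfold_locales
  have conj: "(H #> h) \<otimes>\<^bsub>G Mod H\<^esub> (H #> g) \<otimes>\<^bsub>G Mod H\<^esub> inv\<^bsub>G Mod H\<^esub> (H #> h) = H #> (h \<otimes> g \<otimes> inv h)"
    if "h \<in> carrier G" for h
    using that g by (simp only: hom.hom_mult hom.hom_inv m_closed inv_closed)
  have "conj_class (G Mod H) (H #> g)
      = (\<lambda>h. (H #> h) \<otimes>\<^bsub>G Mod H\<^esub> (H #> g) \<otimes>\<^bsub>G Mod H\<^esub> inv\<^bsub>G Mod H\<^esub> (H #> h)) ` carrier G"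
    unfolding conj_class_def carrier_FactGroup by blast
  also have "\<dots> = (\<lambda>h. H #> (h \<otimes> g \<otimes> inv h)) ` carrier G"
    using conj by (intro image_cong) auto
  also have "\<dots> = (\<lambda>x. H #> x) ` conj_class G g"
    unfolding conj_class_def by blast
  finally show ?thesis .
qed

end

theorem theorem6:
  fixes G :: "('a, 'b) monoid_scheme"
    and N M :: "'a set"
    and g :: 'a
    and \<chi> :: "'a set \<Rightarrow> complex"
  assumes "group G" and "finite (carrier G)"
    and "N \<lhd> G" and "M \<lhd> G" and "N \<subset> M"
    and "g \<in> M - N"
    and "conj_class G g = M - N"
    and "Irr_over (G Mod N) (carrier (G\<lparr>carrier := M\<rparr> Mod N)) = {\<chi>}"
  shows "\<exists>p. prime p \<and>
    (let d = \<chi> \<one>\<^bsub>G Mod N\<^esub>;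
         m = group_index G M;
         c = card (centralizer G g);
         \<psi> = inflation G N \<chi>
     in (complex_of_nat c = of_nat m * (of_nat m + d\<^sup>2) / d\<^sup>2 \<and>
         c = card (centralizer (G Mod N) (N #>\<^bsub>G\<^esub> g)) \<and>
         c = p_part p (Coset.order (G Mod N)) \<and>
         (\<exists>k. c = p ^ k)) \<and>
        ((\<forall>x\<in>N. \<psi> x = of_nat (p'_part p m) * complex_of_real (sqrt (real (p_part p m)))) \<and>
         (\<forall>x\<in>M - N. \<psi> x = - (of_nat m / d) \<and>
                    \<psi> x = - complex_of_real (sqrt (real (p_part p m)))) \<and>
         (\<forall>x\<in>carrier G - M. \<psi> x = 0)))"
proof -
  interpret G: group G by (rule assms(1))
  interpret N: normal N G by (rule assms(3))
  interpret M: normal M G by (rule assms(4))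
  define Q where "Q = G Mod N"
  interpret Q: group Q unfolding Q_def by (rule N.factorgroup_is_group)
  interpret pr: group_hom G Q "\<lambda>x. N #>\<^bsub>G\<^esub> x"
    unfolding Q_def using N.r_coset_hom_Mod N.factorgroup_is_group
    by (simp add: group_hom_def group_hom_axioms_def assms(1))
  have NM: "N \<subseteq> M" using assms(5) by blast
  have gG: "g \<in> carrier G" using assms(6) M.subset by blast
  have carQ: "carrier Q = (\<lambda>x. N #>\<^bsub>G\<^esub> x) ` carrier G" unfolding Q_def by (rule carrier_FactGroup)
  have oneQ: "\<one>\<^bsub>Q\<^esub> = N" by (simp add: Q_def)
  define A where "A = carrier (G\<lparr>carrier := M\<rparr> Mod N)"
  have A_img: "A = (\<lambda>x. N #>\<^bsub>G\<^esub> x) ` M"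
    unfolding A_def carrier_FactGroup by (simp add: r_coset_def)
  have inA: "N #>\<^bsub>G\<^esub> x \<in> A \<longleftrightarrow> x \<in> M" if x: "x \<in> carrier G" for x
  proof
    assume "N #>\<^bsub>G\<^esub> x \<in> A"
    then obtain y where y: "y \<in> M" "N #>\<^bsub>G\<^esub> x = N #>\<^bsub>G\<^esub> y" unfolding A_img by blast
    have "x \<in> N #>\<^bsub>G\<^esub> y" using G.rcos_self[OF x N.is_subgroup] y by simp
    then obtain n where "n \<in> N" "x = n \<otimes>\<^bsub>G\<^esub> y" by (auto simp: r_coset_def)
    then show "x \<in> M" using NM y by auto
  qed (auto simp: A_img)
  have isone: "N #>\<^bsub>G\<^esub> x = N \<longleftrightarrow> x \<in> N" if x: "x \<in> carrier G" for x
    using G.coset_join1[of N x] G.coset_join2[of x N] x N.is_subgroup by blast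
  have finQ: "finite (carrier Q)" unfolding carQ using assms(2) by simp
  have A: "A \<lhd> Q" unfolding A_img
    using M.surj_hom_normal_subgroup[OF pr.group_hom_axioms carQ[symmetric]] .
  have gA: "N #>\<^bsub>G\<^esub> g \<in> A" using assms(6) unfolding A_img by blast
  have trans: "conj_class Q (N #>\<^bsub>G\<^esub> g) = A - {\<one>\<^bsub>Q\<^esub>}"
    unfolding Q_def N.conj_class_FactGroup[OF gG] assms(7)
    unfolding A_img one_FactGroup using isone M.subset by blast
  have sole: "Irr_over Q A = {\<chi>}" using assms(8) unfolding Q_def A_def .
  obtain p m d where p: "prime p" and d: "d > 0" and m: "m > 0" and a1: "card A > 1"
    and q: "Coset.order Q = m * card A"
    and d2: "d\<^sup>2 = m * (card A - 1)" and mp: "m = p_part p m * (card A - 1)"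
    and mp': "p'_part p m = card A - 1" and qp: "p_part p (Coset.order Q) = p_part p m * card A"
    and Ap: "\<exists>k. card A = p ^ k"
    and vals: "\<chi> \<one>\<^bsub>Q\<^esub> = of_nat d" "\<And>x. x \<in> A \<Longrightarrow> x \<noteq> \<one>\<^bsub>Q\<^esub> \<Longrightarrow> \<chi> x = - (of_nat m / of_nat d)"
      "\<And>x. x \<in> carrier Q \<Longrightarrow> x \<notin> A \<Longrightarrow> \<chi> x = 0"
    by (rule Q.sole_character_of_transitive_normal_subgroup[OF finQ A gA trans sole]) (rule that)
  have finM: "finite M" using assms(2) M.subset finite_subset by blast
  have finA: "finite A" unfolding A_img using finM by simp
  have oQ: "Coset.order Q * card N = Coset.order G"
    using G.lagrange[OF N.is_subgroup] by (simp add: Q_def FactGroup_def Coset.order_def)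
  have aN: "card A * card N = card M"
  proof -
    interpret GM: group "G\<lparr>carrier := M\<rparr>" using M.subgroup_is_group[OF assms(1)] .
    have "subgroup N (G\<lparr>carrier := M\<rparr>)"
      using G.subgroup_incl[OF N.is_subgroup M.is_subgroup NM] .
    from GM.lagrange[OF this] show ?thesis by (simp add: A_def FactGroup_def Coset.order_def)
  qed
  have N0: "card N > 0" using N.one_closed finM NM by (metis card_gt_0_iff empty_iff finite_subset)
  have m_eq: "group_index G M = m"
  proof -
    have "group_index G M * card A * card N = m * card A * card N"
      using G.lagrange[OF M.is_subgroup] oQ q aN by (simp add: group_index_def mult.assoc)
    then show ?thesis using a1 N0 by simp
  qed
  have card_class: "card (conj_class Q (N #>\<^bsub>G\<^esub> g)) = card A - 1"
    unfolding trans using finA A by (simp add: normal_imp_subgroup subgroup.one_closed)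
  \<comment> \<open>The common value \<open>ma/(a - 1) = m\<^sub>pa\<close> of the two centralizer orders.\<close>
  have s: "m * card A = (card A - 1) * (p_part p m * card A)"
    using mp by (metis mult.assoc mult.commute)
  have cQ: "card (centralizer Q (N #>\<^bsub>G\<^esub> g)) = p_part p m * card A"
  proof -
    have "(card A - 1) * card (centralizer Q (N #>\<^bsub>G\<^esub> g)) = (card A - 1) * (p_part p m * card A)"
      using Q.card_conj_class_centralizer[of "N #>\<^bsub>G\<^esub> g"] gG card_class q s by simp
    then show ?thesis using a1 by simp
  qed
  have cG: "card (centralizer G g) = p_part p m * card A"
  proof -
    have "card (conj_class G g) = card M - card N"
      unfolding assms(7) using finM NM by (simp add: card_Diff_subset finite_subset)
    also have "\<dots> = (card A - 1) * card N" using aN by (simp add: diff_mult_distrib)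
    finally have "(card A - 1) * card N * card (centralizer G g) = m * card A * card N"
      using G.card_conj_class_centralizer[OF gG] oQ q by simp
    then have "((card A - 1) * card N) * card (centralizer G g) = ((card A - 1) * card N) * (p_part p m * card A)"
      unfolding s by (simp only: ac_simps)
    then show ?thesis using a1 N0 by simp
  qed
  have sq: "real d = real (card A - 1) * sqrt (real (p_part p m))"
  proof -
    have "d\<^sup>2 = p_part p m * (card A - 1) * (card A - 1)"
      unfolding d2 by (rule arg_cong[OF mp, of "\<lambda>i. i * (card A - 1)"])
    then have "d\<^sup>2 = (card A - 1)\<^sup>2 * p_part p m" by (simp only: power2_eq_square ac_simps)
    then have "(real d)\<^sup>2 = (real (card A - 1))\<^sup>2 * real (p_part p m)"
      by (metis of_nat_mult of_nat_power)
    then have "sqrt ((real d)\<^sup>2) = sqrt ((real (card A - 1))\<^sup>2 * real (p_part p m))" by simp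
    then show ?thesis by (simp add: real_sqrt_mult)
  qed
  have md: "real m / real d = sqrt (real (p_part p m))"
  proof -
    have "real m = (sqrt (real (p_part p m)) * sqrt (real (p_part p m))) * real (card A - 1)"
      using mp by (metis of_nat_mult real_sqrt_mult_self abs_of_nat)
    then have "real m = sqrt (real (p_part p m)) * real d" using sq by simp
    then show ?thesis using d by simp
  qed
  have cform: "complex_of_nat (p_part p m * card A) = of_nat m * (of_nat m + (of_nat d)\<^sup>2) / (of_nat d)\<^sup>2"
  proof -
    have "m + d\<^sup>2 = m * card A"
      using d2 a1 by (metis add.commute le_add_diff_inverse2 less_imp_le mult.right_neutral distrib_left)
    then have "p_part p m * card A * d\<^sup>2 = m * (m + d\<^sup>2)"
      unfolding d2 using mp by (metis mult.assoc mult.commute)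
    then have "complex_of_nat (p_part p m * card A) * (of_nat d)\<^sup>2 = of_nat m * (of_nat m + (of_nat d)\<^sup>2)"
      by (metis of_nat_add of_nat_mult of_nat_power)
    then show ?thesis using d by (simp add: field_simps)
  qed
  have infl: "inflation G N \<chi> x = \<chi> (N #>\<^bsub>G\<^esub> x)" if "x \<in> carrier G" for x
    using that by (simp add: inflation_def)
  have mdc: "of_nat m / of_nat d = complex_of_real (sqrt (real (p_part p m)))"
    unfolding md[symmetric] by simp
  have degc: "of_nat d = of_nat (p'_part p m) * complex_of_real (sqrt (real (p_part p m)))"
    unfolding mp' using sq by (metis of_real_mult of_real_of_nat_eq)
  have on_N: "inflation G N \<chi> x = of_nat d" if "x \<in> N" for x
    using that infl[of x] isone[of x] N.mem_carrier[OF that] vals(1) oneQ by simp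
  have on_M: "inflation G N \<chi> x = - (of_nat m / of_nat d)" if "x \<in> M - N" for x
  proof -
    have "x \<in> carrier G" using that M.mem_carrier by blast
    then show ?thesis using that infl isone inA vals(2) oneQ by simp
  qed
  have off_M: "inflation G N \<chi> x = 0" if "x \<in> carrier G - M" for x
    using that infl inA[of x] vals(3)[of "N #>\<^bsub>G\<^esub> x"] carQ by auto
  obtain k where k: "card A = p ^ k" using Ap by blast
  have cp: "\<exists>k. p_part p m * card A = p ^ k"
    unfolding k p_part_def by (metis power_add)
  show ?thesis
    unfolding Let_def Q_def[symmetric] cG cQ m_eq vals(1)
    using p cform cp on_N on_M off_M mdc degc qp by (intro exI[of _ p]) auto
qed

end
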